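(* Given $\boldsymbol\mu=(\mu_1,\dots,\mu_n)\in\mathbb R^n$ (with $\mu_i>0$), $\boldsymbol\sigma=(\sigma_1,\dots,\sigma_n)\in\mathbb R_+^n$, and a convex distortion function $h$, the optimal value of the multi-product problem $$\rho_h^{\rm wc}(\boldsymbol\mu,\boldsymbol\sigma)=\inf_{\boldsymbol x\in\mathbb R_+^n}\ \sup_{F\in\mathcal S(\boldsymbol\mu,\boldsymbol\sigma)}\rho_h^F\Big(\sum_{i=1}^n\psi_i(x_i,p_i,c_i)\Big)$$ is $$\rho_h^{\rm wc}(\boldsymbol\mu,\boldsymbol\sigma)=\sup_{F\in\mathcal S(\boldsymbol\mu,\boldsymbol\sigma)}\rho_h^F\Big(\sum_{i=1}^n\psi_i(x_i^*,p_i,c_i)\Big)=\sum_{i=1}^n\rho_h^{\rm wc}(\mu_i,\sigma_i),$$ where, for each $i=1,\dots,n$, $x_i^*$ and $\rho_h^{\rm wc}(\mu_i,\sigma_i)$ are the optimal order quantity $x^*$ and optimal value $\rho_h^{\rm wc}(\mu,\sigma)$ given by the single-product solution (i)–(iii) recalled in the context, with $\mu=\mu_i$ and $\sigma=\sigma_i$ (and $p=p_i$, $c=c_i$).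
   Context: A convex distortion function is a non-decreasing convex $h:[0,1]\to[0,1]$ with $h(0)=0$, $h(1)=1$. $h'$ is the left-continuous function equal to its left derivative on $(0,1]$, with $h'(0)$ the right derivative at $0$; $h'(s+)$ is the right limit of $h'$ at $s$. The distortion functional is $\rho_h(X)=\int_0^1\mathrm{VaR}_\alpha(X)\,dh(\alpha)$, $\mathrm{VaR}_\alpha(X)=\inf\{x:\mathbb P(X\le x)\ge\alpha\}$. $\rho_h^F$ denotes $\rho_h$ evaluated when the demand (vector) has distribution $F$. Multi-product setting: $p_i>c_i>0$ are the unit price and unit cost of product $i$, and $\psi_i(x,p_i,c_i)=p_i\max\{-S_i,-x\}+c_ix$ is its loss when $x$ units are ordered and its demand is $S_i$. $\mathcal S(\boldsymbol\mu,\boldsymbol\sigma)$ is the set of cdfs $F$ on $[0,\infty)^n$ of $\boldsymbol S=(S_1,\dots,S_n)$ with $\mathbb E^F[\boldsymbol S]=\boldsymbol\mu$ and $\mathrm{Var}^F(S_i)=\sigma_i^2$, $i=1,\dots,n$ (arbitrary dependence). Single-product problem: $\rho_h^{\rm wc}(\mu,\sigma)=\min_{x\ge0}\sup_{F\in\mathcal S(\mu,\sigma)}\rho_h^F(p\max\{-S,-x\}+cx)$, where $p>c>0$ and $\mathcal S(\mu,\sigma)$ is the set of cdfs on $[0,\infty)$ with mean $\mu$ and variance $\sigma^2$. Its solution, stated for convex distortion functions $h$ with $\int_0^1(h'(u))^2du<\infty$, is as follows. Put $\beta=c/p$, $r=\sigma/\mu$, $s^*=h^{-1}(\beta)$, $\Delta_{s^*,t}=\sqrt{t\int_{s^*}^t(h'(u))^2du-(h(t)-\beta)^2}$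 for $t\ge s^*$, $\sigma_t=\sqrt{t(\mu^2+\sigma^2)-\mu^2}$ for $t\in[\frac1{1+r^2},1]$, and let $h^\tau(s)$ be any value in $[h'(s),h'(s+)]$. (i) If $r\ge\sqrt{1/s^*-1}$: $\rho_h^{\rm wc}(\mu,\sigma)=0$ and $x^*=0$. (ii) If $r\le\frac{\Delta_{s^*,1}}{h'(1)-(1-\beta)}$: $\rho_h^{\rm wc}(\mu,\sigma)=-\mu(p-c)+p\sigma\Delta_{s^*,1}$ and $x^*=\mu-\sigma\frac{h^\tau(s^* )-2(1-\beta)}{2\Delta_{s^*,1}}$. (iii) If $\frac{\Delta_{s^*,1}}{h'(1)-(1-\beta)}<r<\sqrt{1/s^*-1}$: $\rho_h^{\rm wc}(\mu,\sigma)=\frac p{t^*}[-\mu(h(t^* )-\beta)+\sigma_{t^*}\Delta_{s^*,t^*}]$ and $x^*=\frac\mu{t^*}-\frac{\sigma_{t^*}}{t^*}\frac{t^*h^\tau(s^* )-2(h(t^* )-\beta)}{2\Delta_{s^*,t^*}}$, where $$t^*=\max\Big\{t\in\Big[\tfrac1{1+r^2},1\Big]\ \Big|\ (1+r^2)\big(th'(t)-h(t)+\beta\big)^2-\int_0^1\big(h'(u)-h(t)+\beta\big)^2du\le0\Big\}.$$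
   Formalization: In (iii) the integral defining t* is corrected to ∫_0^t (h'(t) − 1{u>s*} h'(u))² du; as printed the value is wrong (h(u)=u², p=1, c=1/4, μ=1, σ=0.8). Square-integrability of h', as in the recalled solution, is assumed, with h continuous (no jump at 1). *)

theory Defs
  imports "HOL-Probability.Probability"
begin

definition convex_distortion :: "(real \<Rightarrow> real) \<Rightarrow> bool" where
  "convex_distortion h \<longleftrightarrow>
     mono_on {0..1} h \<and> convex_on {0..1} h \<and> h 0 = 0 \<and> h 1 = 1"

text \<open>
  The derivative \<open>h'\<close>: the left derivative on \<open>(0,1]\<close>, the right derivative at \<open>0\<close>.
  It takes values in the extended reals because \<open>h'(1) = \<infinity>\<close> is possible, even for
  square-integrable \<open>h'\<close>, as \<open>h(t) = 1 - (1 - t) powr (3/4)\<close> shows. At all other points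
  of \<open>[0,1]\<close> it is finite.
\<close>

definition dist_deriv :: "(real \<Rightarrow> real) \<Rightarrow> real \<Rightarrow> ereal" where
  "dist_deriv h s =
     (if s = 0 then Lim (at_right 0) (\<lambda>u. ereal ((h u - h 0) / (u - 0)))
      else Lim (at_left s) (\<lambda>u. ereal ((h u - h s) / (u - s))))"

definition dist_deriv_right :: "(real \<Rightarrow> real) \<Rightarrow> real \<Rightarrow> ereal" where
  "dist_deriv_right h s = Lim (at_right s) (dist_deriv h)"

abbreviation dist_deriv_real :: "(real \<Rightarrow> real) \<Rightarrow> real \<Rightarrow> real" where
  "dist_deriv_real h u \<equiv> real_of_ereal (dist_deriv h u)"

text \<open>
  A convex distortion function is automatically continuous except for a possible jump at
  \<open>1\<close>. Such a jump would be an atom of \<open>dh\<close> with no density, which a Lebesgue integral of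
  \<open>h'\<^sup>2\<close> does not see; it would also leave the inverse of \<open>h\<close> undefined at levels in the
  jump. Continuity makes \<open>h'\<close> a density of \<open>dh\<close>.
\<close>

definition square_integrable_deriv :: "(real \<Rightarrow> real) \<Rightarrow> bool" where
  "square_integrable_deriv h \<longleftrightarrow>
     continuous_on {0..1} h \<and>
     set_integrable lborel {0..1} (\<lambda>u. (dist_deriv_real h u)\<^sup>2)"

text \<open>
  Value at Risk of a random variable \<open>X\<close> on \<open>M\<close>. It is the intended quantile for
  \<open>0 < \<alpha> < 1\<close>, and for bounded \<open>X\<close> also at \<open>\<alpha> = 1\<close>.
\<close>

definition VaR :: "'a measure \<Rightarrow> ('a \<Rightarrow> real) \<Rightarrow> real \<Rightarrow> real" where
  "VaR M X \<alpha> = Inf {x. measure M {\<omega> \<in> space M. X \<omega> \<le> x} \<ge> \<alpha>}"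

text \<open>
  The Stieltjes measure \<open>dh\<close>, with \<open>h\<close> extended constantly outside \<open>[0,1]\<close>. It has no
  mass at \<open>0\<close>, so the endpoint \<open>\<alpha> = 0\<close>, where the Value at Risk is \<open>-\<infinity>\<close>, is left out of
  the integral.
\<close>

definition dist_measure :: "(real \<Rightarrow> real) \<Rightarrow> real measure" where
  "dist_measure h = interval_measure (\<lambda>s. h (max 0 (min 1 s)))"

definition dist_functional :: "(real \<Rightarrow> real) \<Rightarrow> 'a measure \<Rightarrow> ('a \<Rightarrow> real) \<Rightarrow> real" where
  "dist_functional h M X = (LINT \<alpha>:{0<..1}|dist_measure h. VaR M X \<alpha>)"

text \<open>Loss when \<open>x\<close> units are ordered, demand is \<open>s\<close>, and unit price and cost are \<open>p\<close>, \<open>c\<close>.\<close>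

definition newsvendor_loss :: "real \<Rightarrow> real \<Rightarrow> real \<Rightarrow> real \<Rightarrow> real" where
  "newsvendor_loss p c x s = p * max (- s) (- x) + c * x"

definition has_mean_std :: "'a measure \<Rightarrow> ('a \<Rightarrow> real) \<Rightarrow> real \<Rightarrow> real \<Rightarrow> bool" where
  "has_mean_std M X m s \<longleftrightarrow>
     integrable M X \<and> integrable M (\<lambda>\<omega>. (X \<omega>)\<^sup>2) \<and>
     (LINT \<omega>|M. X \<omega>) = m \<and> (LINT \<omega>|M. (X \<omega> - m)\<^sup>2) = s\<^sup>2"

text \<open>
  Uncertainty sets: a distribution function on \<open>[0,\<infinity>)\<close> or \<open>[0,\<infinity>)\<^sup>n\<close> is represented by the
  corresponding Borel probability measure.
\<close>

definition demand_laws :: "real \<Rightarrow> real \<Rightarrow> real measure set" where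
  "demand_laws m s =
     {F. prob_space F \<and> sets F = sets borel \<and> (AE y in F. 0 \<le> y) \<and>
         has_mean_std F (\<lambda>y. y) m s}"

definition joint_demand_laws :: "real ^ 'n \<Rightarrow> real ^ 'n \<Rightarrow> (real ^ 'n) measure set" where
  "joint_demand_laws m s =
     {F. prob_space F \<and> sets F = sets borel \<and> (AE S in F. \<forall>i. 0 \<le> S $ i) \<and>
         (\<forall>i. has_mean_std F (\<lambda>S. S $ i) (m $ i) (s $ i))}"

definition worst_case ::
    "(real \<Rightarrow> real) \<Rightarrow> real \<Rightarrow> real \<Rightarrow> real \<Rightarrow> real \<Rightarrow> real \<Rightarrow> ereal" where
  "worst_case h p c m s x =
     (SUP F\<in>demand_laws m s. ereal (dist_functional h F (newsvendor_loss p c x)))"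

definition optimal_value ::
    "(real \<Rightarrow> real) \<Rightarrow> real \<Rightarrow> real \<Rightarrow> real \<Rightarrow> real \<Rightarrow> ereal" where
  "optimal_value h p c m s = (INF x\<in>{0..}. worst_case h p c m s x)"

definition multi_worst_case ::
    "(real \<Rightarrow> real) \<Rightarrow> real ^ 'n \<Rightarrow> real ^ 'n \<Rightarrow> real ^ 'n \<Rightarrow> real ^ 'n \<Rightarrow> real ^ 'n \<Rightarrow> ereal" where
  "multi_worst_case h p c m s x =
     (SUP F\<in>joint_demand_laws m s.
        ereal (dist_functional h F (\<lambda>S. \<Sum>i\<in>UNIV. newsvendor_loss (p $ i) (c $ i) (x $ i) (S $ i))))"

definition multi_optimal_value ::
    "(real \<Rightarrow> real) \<Rightarrow> real ^ 'n \<Rightarrow> real ^ 'n \<Rightarrow> real ^ 'n \<Rightarrow> real ^ 'n \<Rightarrow> ereal" where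
  "multi_optimal_value h p c m s = (INF x\<in>{x. \<forall>i. 0 \<le> x $ i}. multi_worst_case h p c m s x)"

text \<open>
  The single-product solution, with \<open>\<beta> = c / p\<close> and \<open>r = s / m\<close>.

  For \<open>0 < \<beta> < 1\<close> and continuous \<open>h\<close>, the level \<open>\<beta>\<close> is attained at exactly one point of
  \<open>[0,1]\<close>.
\<close>

definition crit_level :: "(real \<Rightarrow> real) \<Rightarrow> real \<Rightarrow> real" where
  "crit_level h \<beta> = inv_into {0..1} h \<beta>"

definition Delta :: "(real \<Rightarrow> real) \<Rightarrow> real \<Rightarrow> real \<Rightarrow> real" where
  "Delta h \<beta> t =
     sqrt (t * (LBINT u:{crit_level h \<beta>..t}. (dist_deriv_real h u)\<^sup>2) - (h t - \<beta>)\<^sup>2)"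

definition sigma_trunc :: "real \<Rightarrow> real \<Rightarrow> real \<Rightarrow> real" where
  "sigma_trunc m s t = sqrt (t * (m\<^sup>2 + s\<^sup>2) - m\<^sup>2)"

text \<open>
  Put \<open>w(u) = h'(u)\<close> for \<open>u > s*\<close> and \<open>w(u) = 0\<close> otherwise, where \<open>s*\<close> is the critical level.
  The worst-case demand, as a function of the quantile level of the loss, is a multiple of the
  positive part of \<open>\<lambda> - w\<close>. With \<open>\<lambda> = h'(t)\<close> this function lives on \<open>[0,t]\<close>, where it has
  integral \<open>t h'(t) - h(t) + \<beta>\<close>. The inequality says that its ratio of second moment to
  squared mean is at least \<open>1 + r\<^sup>2\<close>; equivalently, the demand supported on \<open>[0,t]\<close> that is
  optimal when its sign is disregarded is nonnegative.

  If \<open>h'(1) = \<infinity>\<close>, the left-hand side is \<open>\<infinity>\<close> at \<open>t = 1\<close>, so that \<open>t = 1\<close> is excluded.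
\<close>

definition trunc_feasible :: "(real \<Rightarrow> real) \<Rightarrow> real \<Rightarrow> real \<Rightarrow> real \<Rightarrow> bool" where
  "trunc_feasible h \<beta> r t \<longleftrightarrow>
     1 / (1 + r\<^sup>2) \<le> t \<and> t \<le> 1 \<and>
     ereal (1 + r\<^sup>2) * (ereal t * dist_deriv h t - ereal (h t) + ereal \<beta>)\<^sup>2
       - ereal (LBINT u:{0..t}.
           (dist_deriv_real h t - indicator {crit_level h \<beta><..} u * dist_deriv_real h u)\<^sup>2) \<le> 0"

definition trunc_level :: "(real \<Rightarrow> real) \<Rightarrow> real \<Rightarrow> real \<Rightarrow> real" where
  "trunc_level h \<beta> r = (GREATEST t. trunc_feasible h \<beta> r t)"

definition ratio_low :: "(real \<Rightarrow> real) \<Rightarrow> real \<Rightarrow> ereal" where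
  "ratio_low h \<beta> = ereal (Delta h \<beta> 1) / (dist_deriv h 1 - ereal (1 - \<beta>))"

definition ratio_high :: "(real \<Rightarrow> real) \<Rightarrow> real \<Rightarrow> real" where
  "ratio_high h \<beta> = sqrt (1 / crit_level h \<beta> - 1)"

text \<open>
  \<open>single_solution h p c m s x v\<close>: the closed-form solution yields order quantity \<open>x\<close> and
  value \<open>v\<close>. This is a relation because \<open>x\<close> depends on the choice of \<open>\<tau>\<close> between
  \<open>h'(s*)\<close> and \<open>h'(s*+)\<close>, and because the first two cases may overlap when
  \<open>s / m = ratio_high\<close>.
\<close>

inductive single_solution ::
    "(real \<Rightarrow> real) \<Rightarrow> real \<Rightarrow> real \<Rightarrow> real \<Rightarrow> real \<Rightarrow> real \<Rightarrow> real \<Rightarrow> bool"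
  for h p c m s where
  no_order:
    "s / m \<ge> ratio_high h (c / p) \<Longrightarrow> single_solution h p c m s 0 0"
| low_dispersion:
    "\<lbrakk> ereal (s / m) \<le> ratio_low h \<beta>;
       \<beta> = c / p;
       dist_deriv h (crit_level h \<beta>) \<le> ereal \<tau>; ereal \<tau> \<le> dist_deriv_right h (crit_level h \<beta>);
       x = m - s * ((\<tau> - 2 * (1 - \<beta>)) / (2 * Delta h \<beta> 1));
       v = - m * (p - c) + p * s * Delta h \<beta> 1 \<rbrakk>
     \<Longrightarrow> single_solution h p c m s x v"
| mid_dispersion:
    "\<lbrakk> ratio_low h \<beta> < ereal (s / m); s / m < ratio_high h \<beta>;
       \<beta> = c / p; t = trunc_level h \<beta> (s / m);
       dist_deriv h (crit_level h \<beta>) \<le> ereal \<tau>; ereal \<tau> \<le> dist_deriv_right h (crit_level h \<beta>);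
       x = m / t - sigma_trunc m s t / t * ((t * \<tau> - 2 * (h t - \<beta>)) / (2 * Delta h \<beta> t));
       v = p / t * (- m * (h t - \<beta>) + sigma_trunc m s t * Delta h \<beta> t) \<rbrakk>
     \<Longrightarrow> single_solution h p c m s x v"

end

theory Submission
  imports Defs
begin

text \<open>
  Both the single-product and the multi-product problem have a saddle point. Let
  \<open>w = h' 1\<^bsub>(s*,1]\<^esub>\<close>. Exchanging infimum and supremum, the single-product problem becomes the
  minimization of \<open>\<integral> Y w\<close> over the nonnegative decreasing \<open>Y\<close> on \<open>(0,1)\<close> with the prescribed
  mean and second moment; the minimizer is \<open>Y = (A - B w)\<^sup>+\<close>, which lives on \<open>[0,t*]\<close>. With the
  order quantity \<open>x = A - B \<tau> / 2\<close>, the value \<open>y = Y u\<close> maximizes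
  \<open>\<psi>(x, y) h'(u) - (a y\<^sup>2 + b y)\<close> over \<open>y \<ge> 0\<close> for every level \<open>u\<close>, where \<open>a = p / (2B)\<close> and
  \<open>b = - p A / B\<close>. This pointwise inequality can be summed over the products and integrated against
  an arbitrary joint law of the demands, because the penalty depends only on their first two
  moments. So the sum of the single-product values is an upper bound under any dependence, and the
  comonotone coupling of the worst-case demands attains it.
\<close>

section \<open>The left derivative of a distortion function\<close>

text \<open>At a level with h'(u) = k, and up to terms free of y, the penalized loss is -p / (2B)
  times 2 B k min(y, x) + (y - A)^2. The minimum makes this nonconvex: the candidates are y = A - B
  k on y \<le> x and y = A on y \<ge> x, with values 2 A B k - (B k)^2 and 2 B k x. The first is the
  better one exactly when x \<ge> A - B k / 2. The worst-case demand has to switch from one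
  candidate to the other at s*, hence x = A - B \<tau> / 2, and every \<tau> between the one-sided
  derivatives separates the levels below s* from those above. The coefficients a and b are those for
  which A - B k is stationary. The remaining difficulty is that t* is given as the largest solution
  of an inequality, whereas optimality requires A - B h' to change sign at t*. As h' may jump there,
  the sign beyond t* is obtained only as a limit from the right; as h'(1) may be infinite, the
  inequality is handled in the extended reals at 1.\<close>

locale sq_distortion =
  fixes h :: "real \<Rightarrow> real"
  assumes distortion: "convex_distortion h"
    and sq_integrable: "square_integrable_deriv h"
begin

text \<open>\<open>real_of_ereal\<close> sends \<infinity> to 0, so \<open>d 1\<close> is 0 when the
  slope of \<open>h\<close> at 1 is infinite. Pointwise facts about \<open>d\<close> are therefore
  confined to 0 < s < 1; those that reach 1 are stated for \<open>dist_deriv\<close>.\<close>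

definition d :: "real \<Rightarrow> real" where "d u = dist_deriv_real h u"

lemma h0 [simp]: "h 0 = 0" and h1 [simp]: "h 1 = 1"
  using distortion by (auto simp: convex_distortion_def)

lemma h_mono: "0 \<le> u \<Longrightarrow> u \<le> v \<Longrightarrow> v \<le> 1 \<Longrightarrow> h u \<le> h v"
  using distortion by (auto simp: convex_distortion_def mono_on_def)

lemma h_cont: "continuous_on {0..1} h"
  using sq_integrable by (simp add: square_integrable_deriv_def)

lemma slope_le:
  assumes "0 \<le> a" "a < b" "b < e" "e \<le> 1"
  shows "(h b - h a) / (b - a) \<le> (h e - h a) / (e - a)"
    and "(h e - h a) / (e - a) \<le> (h e - h b) / (e - b)"
proof -
  have "convex_on {0..1} h" using distortion by (simp add: convex_distortion_def)
  note sl = convex_on_slope_le[OF this, of a e b]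
  have flip: "(h x - h y) / (x - y) = (h y - h x) / (y - x)" for x y
    using minus_divide_divide[of "h y - h x" "y - x"] by simp
  show "(h b - h a) / (b - a) \<le> (h e - h a) / (e - a)"
    and "(h e - h a) / (e - a) \<le> (h e - h b) / (e - b)"
    using sl assms flip[of a b] flip[of a e] flip[of b e] by auto
qed

definition slope :: "real \<Rightarrow> real \<Rightarrow> real" where
  "slope a b = (h b - h a) / (b - a)"

lemma slope_mono:
  assumes "0 \<le> a" "a < b" "a \<le> a'" "b \<le> b'" "a' < b'" "b' \<le> 1"
  shows "slope a b \<le> slope a' b'"
proof -
  have "slope a b \<le> slope a b'"
    using slope_le(1)[of a b b'] assms by (cases "b = b'") (auto simp: slope_def)
  also have "\<dots> \<le> slope a' b'"
    using slope_le(2)[of a a' b'] assms by (cases "a = a'") (auto simp: slope_def)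
  finally show ?thesis .
qed

text \<open>By convexity the slopes towards \<open>s\<close> increase with the left end, so their
  left limit exists in the extended reals and is a supremum. Bounds on the derivative then come from
  single slopes.\<close>

lemma dist_deriv_tendsto:
  assumes "0 < s" "s \<le> 1"
  shows "((\<lambda>u. ereal (slope u s)) \<longlongrightarrow> (SUP u\<in>{0..<s}. ereal (slope u s))) (at_left s)"
proof (rule order_tendstoI)
  have ev: "\<forall>\<^sub>F u in at_left s. u \<in> {b<..<s}" if "b < s" for b
    using that by (intro eventually_at_leftI[of b]) auto
  fix l assume "l < (SUP u\<in>{0..<s}. ereal (slope u s))"
  then obtain b where b: "b \<in> {0..<s}" "l < ereal (slope b s)"
    by (auto simp: less_SUP_iff)
  then have "b < s" by simp
  from ev[OF this] show "\<forall>\<^sub>F u in at_left s. l < ereal (slope u s)"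
  proof eventually_elim
    case (elim u)
    have "slope b s \<le> slope u s" using b elim assms by (intro slope_mono) auto
    then show ?case using b(2) by (meson ereal_less_eq(3) less_le_trans)
  qed
next
  fix l assume l: "(SUP u\<in>{0..<s}. ereal (slope u s)) < l"
  have "\<forall>\<^sub>F u in at_left s. u \<in> {0<..<s}"
    using assms by (intro eventually_at_leftI[of 0]) auto
  then show "\<forall>\<^sub>F u in at_left s. ereal (slope u s) < l"
  proof eventually_elim
    case (elim u)
    then have "ereal (slope u s) \<le> (SUP u\<in>{0..<s}. ereal (slope u s))"
      by (intro SUP_upper) auto
    then show ?case using l by (rule le_less_trans)
  qed
qed

lemma dist_deriv_eq:
  assumes "0 < s" "s \<le> 1"
  shows "dist_deriv h s = (SUP u\<in>{0..<s}. ereal (slope u s))"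
proof -
  have "(\<lambda>u. ereal ((h u - h s) / (u - s))) = (\<lambda>u. ereal (slope u s))"
  proof
    fix u
    have "(h u - h s) / (u - s) = (- (h s - h u)) / (- (s - u))" by simp
    then show "ereal ((h u - h s) / (u - s)) = ereal (slope u s)"
      unfolding slope_def minus_divide_divide by simp
  qed
  then show ?thesis
    using assms tendsto_Lim[OF _ dist_deriv_tendsto[OF assms]] by (simp add: dist_deriv_def)
qed

lemma slope_le_dist_deriv: "0 \<le> u \<Longrightarrow> u < s \<Longrightarrow> s \<le> 1 \<Longrightarrow> ereal (slope u s) \<le> dist_deriv h s"
  by (subst dist_deriv_eq) (auto intro!: SUP_upper)

lemma dist_deriv_le_slope: "0 < s \<Longrightarrow> s < v \<Longrightarrow> v \<le> 1 \<Longrightarrow> dist_deriv h s \<le> ereal (slope s v)"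
  by (subst dist_deriv_eq) (auto intro!: SUP_least slope_mono)

lemma slope_nonneg: "0 \<le> u \<Longrightarrow> u < s \<Longrightarrow> s \<le> 1 \<Longrightarrow> 0 \<le> slope u s"
  using h_mono[of u s] by (auto simp: slope_def)

lemma dist_deriv_mono:
  assumes "0 < s" "s \<le> t" "t \<le> 1"
  shows "dist_deriv h s \<le> dist_deriv h t"
proof (cases "s = t")
  case False
  then have "dist_deriv h s \<le> ereal (slope s t)" using assms by (intro dist_deriv_le_slope) auto
  also have "\<dots> \<le> dist_deriv h t" using assms False by (intro slope_le_dist_deriv) auto
  finally show ?thesis .
qed simp

lemma dist_deriv_nonneg: "0 < s \<Longrightarrow> s \<le> 1 \<Longrightarrow> 0 \<le> dist_deriv h s"
  using slope_le_dist_deriv[of 0 s] slope_nonneg[of 0 s]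
  by (auto intro: order_trans[of 0 "ereal (slope 0 s)"])

lemma dist_deriv_real: "0 < s \<Longrightarrow> s < 1 \<Longrightarrow> dist_deriv h s = ereal (d s)"
  using dist_deriv_le_slope[of s 1] dist_deriv_nonneg[of s]
  unfolding d_def by (intro ereal_real'[symmetric]) auto

lemma d_nonneg: "0 < s \<Longrightarrow> s < 1 \<Longrightarrow> 0 \<le> d s"
  using dist_deriv_nonneg[of s] by (simp add: d_def real_of_ereal_pos)

lemma d_mono: "0 < s \<Longrightarrow> s \<le> t \<Longrightarrow> t < 1 \<Longrightarrow> d s \<le> d t"
  using dist_deriv_mono[of s t] by (simp add: dist_deriv_real)

lemma slope_le_d: "0 \<le> u \<Longrightarrow> u < s \<Longrightarrow> s < 1 \<Longrightarrow> slope u s \<le> d s"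
  using slope_le_dist_deriv[of u s] by (simp add: dist_deriv_real)

lemma d_le_slope: "0 < s \<Longrightarrow> s < v \<Longrightarrow> v \<le> 1 \<Longrightarrow> d s \<le> slope s v"
  using dist_deriv_le_slope[of s v] by (simp add: dist_deriv_real)

text \<open>For fixed \<open>b\<close> the slope from \<open>b\<close> to \<open>t\<close> is
  continuous in \<open>t\<close> and bounds the derivative at \<open>t\<close> from below, which
  gives the lower half; monotonicity gives the upper half.\<close>

lemma dist_deriv_left_cont:
  assumes "0 < s" "s \<le> 1"
  shows "(dist_deriv h \<longlongrightarrow> dist_deriv h s) (at_left s)"
proof (rule order_tendstoI)
  fix l assume "l < dist_deriv h s"
  then obtain b where b: "0 \<le> b" "b < s" "l < ereal (slope b s)"
    using assms by (auto simp: dist_deriv_eq less_SUP_iff)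
  have "continuous_on {0..s} h"
    using h_cont assms by (elim continuous_on_subset) auto
  then have "(h \<longlongrightarrow> h s) (at_left s)"
    using assms by (intro continuous_on_Icc_at_leftD)
  then have "((\<lambda>t. ereal (slope b t)) \<longlongrightarrow> ereal (slope b s)) (at_left s)"
    using b unfolding slope_def by (intro tendsto_intros) auto
  then have "\<forall>\<^sub>F t in at_left s. l < ereal (slope b t)"
    using b(3) by (rule order_tendstoD)
  moreover have "\<forall>\<^sub>F t in at_left s. t \<in> {b<..<s}"
    using b(2) by (intro eventually_at_leftI[of b]) auto
  ultimately show "\<forall>\<^sub>F t in at_left s. l < dist_deriv h t"
  proof eventually_elim
    case (elim t)
    then show ?case using slope_le_dist_deriv[of b t] b assms by auto
  qed
next
  fix l assume l: "dist_deriv h s < l"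
  have "\<forall>\<^sub>F t in at_left s. t \<in> {0<..<s}"
    using assms by (intro eventually_at_leftI[of 0]) auto
  then show "\<forall>\<^sub>F t in at_left s. dist_deriv h t < l"
    by eventually_elim (use assms in \<open>auto intro!: le_less_trans[OF dist_deriv_mono l]\<close>)
qed

text \<open>A monotone function has its infimum over the points beyond \<open>s\<close> as right
  limit. This is how \<tau>, bounded by the right limit at the critical level, is compared with
  \<open>d\<close> at higher levels.\<close>

lemma dist_deriv_right_le:
  assumes "0 < s" "s < u" "u < 1"
  shows "dist_deriv_right h s \<le> dist_deriv h u"
proof -
  let ?L = "INF v\<in>{s<..<1}. dist_deriv h v"
  have "(dist_deriv h \<longlongrightarrow> ?L) (at_right s)"
  proof (rule order_tendstoI)
    fix l assume l: "l < ?L"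
    have "\<forall>\<^sub>F t in at_right s. t \<in> {s<..<1}"
      using assms by (intro eventually_at_rightI[of _ 1]) auto
    then show "\<forall>\<^sub>F t in at_right s. l < dist_deriv h t"
      by eventually_elim (use l in \<open>auto elim!: less_le_trans intro!: INF_lower\<close>)
  next
    fix l assume "?L < l"
    then obtain b where b: "s < b" "b < 1" "dist_deriv h b < l"
      by (auto simp: INF_less_iff)
    have "\<forall>\<^sub>F t in at_right s. t \<in> {s<..<b}"
      using b by (intro eventually_at_rightI[of _ b]) auto
    then show "\<forall>\<^sub>F t in at_right s. dist_deriv h t < l"
      by eventually_elim (use b assms in \<open>auto intro!: le_less_trans[OF dist_deriv_mono b(3)]\<close>)
  qed
  then have "dist_deriv_right h s = ?L"
    unfolding dist_deriv_right_def by (intro tendsto_Lim) auto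
  also have "\<dots> \<le> dist_deriv h u"
    using assms by (intro INF_lower) auto
  finally show ?thesis .
qed

end

section \<open>The uniform distribution on the levels\<close>

text \<open>The open interval keeps out both ends: at 0 the Value at Risk degenerates, and at 1
  \<open>d\<close> may carry a default value.\<close>

abbreviation unif :: "real measure" where "unif \<equiv> restrict_space lborel {0<..<1}"

lemma prob_space_unif: "prob_space unif"
  by (auto simp: space_restrict_space emeasure_restrict_space intro!: prob_spaceI)

interpretation unif: prob_space unif by (rule prob_space_unif)

lemma space_unif [simp]: "space unif = {0<..<1}"
  by (simp add: space_restrict_space)

lemma prob_unif [simp]: "measure unif {0<..<1} = 1"
  using unif.prob_space by simp

lemma sets_unif [measurable_cong]: "sets unif = sets (restrict_space borel {0<..<1})"
  by (simp add: sets_restrict_space)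

lemma AE_unif: "(AE u in unif. P u) \<longleftrightarrow> (AE u in lborel. 0 < u \<and> u < 1 \<longrightarrow> P u)"
  by (subst AE_restrict_space_iff) auto

lemma AE_unif_neq: "AE u in unif. u \<noteq> a"
  unfolding AE_unif using AE_lborel_singleton[of a] by auto

lemma integrable_unif_iff:
  fixes f :: "real \<Rightarrow> real"
  shows "integrable unif f \<longleftrightarrow> set_integrable lborel {0<..<1} f"
  by (simp add: integrable_restrict_space set_integrable_def)

lemma integral_unif_eq:
  fixes f :: "real \<Rightarrow> real"
  shows "(LINT u|unif. f u) = (LINT u:{0<..<1}|lborel. f u)"
  by (simp add: integral_restrict_space set_lebesgue_integral_def)

lemma integrable_unif_indicator:
  fixes f :: "real \<Rightarrow> real"
  assumes "integrable unif f" "A \<in> sets borel"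
  shows "integrable unif (\<lambda>u. indicator A u * f u)"
proof (rule Bochner_Integration.integrable_bound[OF assms(1)])
  have "(indicator A :: real \<Rightarrow> real) \<in> borel_measurable unif"
    using assms by (intro measurable_restrict_space1) auto
  then show "(\<lambda>u. indicator A u * f u) \<in> borel_measurable unif"
    using assms by (intro borel_measurable_times) auto
qed (auto split: split_indicator)

text \<open>Passage between three integrals: over \<open>unif\<close>, where the probabilistic
  arguments run; the Lebesgue integral over a closed interval, in which \<open>Delta\<close> is
  stated; and the gauge integral, which brings additivity and continuity in the limits.\<close>

lemma integral_unif_indicator:
  fixes f :: "real \<Rightarrow> real"
  assumes "integrable unif f" "0 \<le> a" "a \<le> b" "b \<le> 1"
  shows "(LINT u|unif. indicator {a<..b} u * f u) = integral {a..b} f"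
    and "(LINT u:{a..b}|lborel. f u) = integral {a..b} f"
    and "f integrable_on {0..1}"
proof -
  have int: "set_integrable lborel {0<..<1} f"
    using assms(1) by (simp add: integrable_unif_iff)
  have sub: "set_integrable lborel {a<..<b} f"
    using int by (rule set_integrable_subset) (use assms in auto)
  have m: "(\<lambda>u. indicator {a<..<b} u * f u) \<in> borel_measurable lborel"
    using sub by (auto simp: set_integrable_def)
  have "f integrable_on {0<..<1}" by (rule set_borel_integral_eq_integral(1)[OF int])
  then show "f integrable_on {0..1}" by (simp add: integrable_on_Icc_iff_Ioo)
  have i1: "(LINT u:{a<..<b}|lborel. f u) = integral {a..b} f"
    using set_borel_integral_eq_integral(2)[OF sub] by (simp add: integral_open_interval_real)
  \<comment> \<open>Measurability of \<open>f\<close> is known only inside (0,1), so the values at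
    the two ends are added back as multiples of indicators of points; for a = b the point is counted
    once.\<close>
  have m2: "(\<lambda>u. indicator {a..b} u * f u) \<in> borel_measurable lborel"
  proof -
    have "(\<lambda>u. indicator {a..b} u * f u) =
      (\<lambda>u. indicator {a<..<b} u * f u + indicator {a} u * f a + (if a = b then 0 else indicator {b} u * f b))"
      using assms by (auto simp: fun_eq_iff indicator_def)
    then show ?thesis using m by simp
  qed
  have "(LINT u:{a..b}|lborel. f u) = (LINT u:{a<..<b}|lborel. f u)"
    unfolding set_lebesgue_integral_def real_scaleR_def
    using m m2 AE_lborel_singleton[of a] AE_lborel_singleton[of b]
    by (intro integral_cong_AE) (auto split: split_indicator)
  then show "(LINT u:{a..b}|lborel. f u) = integral {a..b} f" by (simp add: i1)
  have "(LINT u|unif. indicator {a<..b} u * f u) = (LINT u:{a<..<b}|lborel. f u)"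
    unfolding integral_unif_eq set_lebesgue_integral_def real_scaleR_def
  proof (rule integral_cong_AE)
    have "integrable unif (\<lambda>u. indicator {a<..b} u * f u)"
      using assms by (intro integrable_unif_indicator) auto
    then show "(\<lambda>u. indicator {0<..<1} u * (indicator {a<..b} u * f u)) \<in> borel_measurable lborel"
      by (simp add: integrable_unif_iff set_integrable_def)
  qed (use assms m AE_lborel_singleton[of b] in \<open>auto split: split_indicator\<close>)
  then show "(LINT u|unif. indicator {a<..b} u * f u) = integral {a..b} f"
    by (simp add: i1)
qed

text \<open>
  Replaces the fundamental theorem of calculus for the monotone derivative of \<open>h\<close>, which may have
  infinitely many jumps.
\<close>

lemma increments_bounded_imp_eq:
  fixes f g :: "real \<Rightarrow> real"
  assumes "a \<le> b"
    and bound: "\<And>x y. a \<le> x \<Longrightarrow> x \<le> y \<Longrightarrow> y \<le> b \<Longrightarrow> \<bar>f y - f x\<bar> \<le> (y - x) * (g y - g x)"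
  shows "f b = f a"
proof -
  \<comment> \<open>On an equidistant partition into n + 1 pieces the bounds add up to the mesh
    times a telescoping sum of \<open>g\<close>, which vanishes as n grows.\<close>
  have "\<bar>f b - f a\<bar> \<le> (b - a) * (g b - g a) / real (Suc n)" for n
  proof -
    define \<delta> where "\<delta> = (b - a) / real (Suc n)"
    define x where "x k = a + real k * \<delta>" for k
    have "real (Suc n) * \<delta> = b - a"
      unfolding \<delta>_def times_divide_eq_right by (rule nonzero_mult_div_cancel_left) simp
    then have "x (Suc n) = a + (b - a)" unfolding x_def by (rule arg_cong)
    then have xn: "x (Suc n) = b" by linarith
    have x0: "x 0 = a" by (simp add: x_def)
    have step: "x (Suc k) - x k = \<delta>" for k
      by (simp add: x_def algebra_simps)
    have "0 \<le> \<delta>" using assms(1) by (simp add: \<delta>_def)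
    then have mono: "x k \<le> x (Suc k)" for k using step[of k] by linarith
    have inc: "i \<le> j \<Longrightarrow> x i \<le> x j" for i j by (rule lift_Suc_mono_le[of x, OF mono])
    have "\<bar>f b - f a\<bar> = \<bar>\<Sum>k<Suc n. f (x (Suc k)) - f (x k)\<bar>"
      using sum_lessThan_telescope[of "\<lambda>k. f (x k)" "Suc n"] x0 xn by simp
    also have "\<dots> \<le> (\<Sum>k<Suc n. \<bar>f (x (Suc k)) - f (x k)\<bar>)" by (rule sum_abs)
    also have "\<dots> \<le> (\<Sum>k<Suc n. \<delta> * (g (x (Suc k)) - g (x k)))"
    proof (rule sum_mono)
      fix k assume "k \<in> {..<Suc n}"
      then have "a \<le> x k" "x (Suc k) \<le> b" using inc[of 0 k] inc[of "Suc k" "Suc n"] x0 xn by auto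
      then show "\<bar>f (x (Suc k)) - f (x k)\<bar> \<le> \<delta> * (g (x (Suc k)) - g (x k))"
        using bound[of "x k" "x (Suc k)"] mono[of k] step[of k] by simp
    qed
    also have "\<dots> = \<delta> * (g b - g a)"
      using sum_lessThan_telescope[of "\<lambda>k. g (x k)" "Suc n"] x0 xn
      by (simp add: sum_distrib_left[symmetric])
    finally show ?thesis by (simp add: \<delta>_def)
  qed
  moreover have "(\<lambda>n. (b - a) * (g b - g a) / real (Suc n)) \<longlonglongrightarrow> 0"
    by (intro real_tendsto_divide_at_top[OF tendsto_const]
        filterlim_compose[OF filterlim_real_sequentially filterlim_Suc])
  ultimately have "\<bar>f b - f a\<bar> \<le> 0"
    by (intro LIMSEQ_le_const) auto
  then show ?thesis by simp
qed

section \<open>Recovering the distortion function from its derivative\<close>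

context sq_distortion
begin

lemma integrable_d2: "integrable unif (\<lambda>u. (d u)\<^sup>2)"
proof -
  have "set_integrable lborel {0..1} (\<lambda>u. (d u)\<^sup>2)"
    using sq_integrable by (simp add: square_integrable_deriv_def d_def)
  then show ?thesis
    unfolding integrable_unif_iff by (rule set_integrable_subset) auto
qed

text \<open>The integrability hypothesis speaks of the square only; as \<open>d\<close> is
  nonnegative inside (0,1), the square root recovers it.\<close>

lemma d_measurable [measurable]: "d \<in> borel_measurable unif"
proof -
  have "(\<lambda>u. sqrt ((d u)\<^sup>2)) \<in> borel_measurable unif"
    using borel_measurable_integrable[OF integrable_d2] by measurable
  then show ?thesis
    by (subst measurable_cong[where g = "\<lambda>u. sqrt ((d u)\<^sup>2)"]) (auto simp: d_nonneg)
qed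

lemma integrable_d: "integrable unif d"
proof (rule Bochner_Integration.integrable_bound)
  show "integrable unif (\<lambda>u. 1 + (d u)\<^sup>2)"
    using integrable_d2 by simp
  have "\<bar>y\<bar> \<le> \<bar>1 + y\<^sup>2\<bar>" for y :: real
  proof -
    have "0 \<le> (\<bar>y\<bar> - 1)\<^sup>2" by simp
    then have "2 * \<bar>y\<bar> \<le> 1 + y\<^sup>2" by (simp add: power2_diff)
    then show ?thesis by linarith
  qed
  then show "AE u in unif. norm (d u) \<le> norm (1 + (d u)\<^sup>2)" by simp
qed simp

text \<open>On [x,y] both the increment of \<open>h\<close> and the integral of \<open>d\<close> lie
  between (y - x) d(x) and (y - x) d(y). Their difference is thus constant on (0,1) by
  \<open>increments_bounded_imp_eq\<close>, and continuity of \<open>h\<close> carries this to the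
  end points.\<close>

lemma integral_d_eq: 
  assumes "0 \<le> x" "x \<le> 1"
  shows "integral {0..x} d = h x"
proof -
  have int: "d integrable_on {0..1}"
    using integral_unif_indicator(3)[OF integrable_d, of 0 0] by simp
  define \<phi> where "\<phi> x = h x - integral {0..x} d" for x
  have cont: "continuous_on {0..1} \<phi>"
    unfolding \<phi>_def by (intro continuous_intros h_cont indefinite_integral_continuous_1 int)
  have sub: "d integrable_on {x..y}" if "0 \<le> x" "y \<le> 1" for x y
    using int by (rule integrable_on_subinterval) (use that in auto)
  have eq: "\<phi> b = \<phi> a" if ab: "0 < a" "a \<le> b" "b < 1" for a b
  proof (rule increments_bounded_imp_eq[where f = \<phi> and g = d])
    fix x y assume xy: "a \<le> x" "x \<le> y" "y \<le> b"
    have I: "integral {0..y} d = integral {0..x} d + integral {x..y} d"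
      using xy ab by (intro Henstock_Kurzweil_Integration.integral_combine[symmetric] sub) auto
    have "integral {x..y} (\<lambda>_. d x) \<le> integral {x..y} d"
      using xy ab by (intro integral_le sub integrable_const_ivl d_mono) auto
    moreover have "integral {x..y} d \<le> integral {x..y} (\<lambda>_. d y)"
      using xy ab by (intro integral_le sub integrable_const_ivl d_mono) auto
    ultimately have b1: "(y - x) * d x \<le> integral {x..y} d" "integral {x..y} d \<le> (y - x) * d y"
      using xy by simp_all
    have b2: "(y - x) * d x \<le> h y - h x \<and> h y - h x \<le> (y - x) * d y"
    proof (cases "x = y")
      case False
      then show ?thesis
        using d_le_slope[of x y] slope_le_d[of x y] xy ab by (simp add: slope_def field_simps)
    qed simp
    have "(y - x) * (d y - d x) = (y - x) * d y - (y - x) * d x" by (rule right_diff_distrib)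
    then show "\<bar>\<phi> y - \<phi> x\<bar> \<le> (y - x) * (d y - d x)"
      using I b1 b2 unfolding \<phi>_def by linarith
  qed (use ab in auto)
  have eq_half: "\<phi> y = \<phi> (1/2)" if y: "y \<in> {0<..<1}" for y
  proof (cases "y \<le> 1/2")
    case True
    show ?thesis by (rule eq[symmetric]) (use y True in auto)
  next
    case False
    show ?thesis by (rule eq) (use y False in auto)
  qed
  have const: "\<phi> y = \<phi> (1/2)" if "0 \<le> y" "y \<le> 1" for y
  proof (rule continuous_constant_on_closure[where f = \<phi> and S = "{0<..<1}"])
    show "continuous_on (closure {0<..<1}) \<phi>" using cont by simp
    show "y \<in> closure {0<..<1}" using that by simp
  qed (rule eq_half)
  have "\<phi> x = \<phi> 0" by (rule trans[OF const const[symmetric]]) (use assms in auto)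
  then show ?thesis by (simp add: \<phi>_def)
qed

lemma integral_unif_d:
  assumes "0 \<le> a" "a \<le> b" "b \<le> 1"
  shows "(LINT u|unif. indicator {a<..b} u * d u) = h b - h a"
proof -
  have int: "d integrable_on {0..1}"
    using integral_unif_indicator(3)[OF integrable_d, of 0 0] by simp
  have "d integrable_on {0..b}"
    using int by (rule integrable_on_subinterval) (use assms in auto)
  then have "integral {0..a} d + integral {a..b} d = integral {0..b} d"
    using assms by (intro Henstock_Kurzweil_Integration.integral_combine) auto
  then show ?thesis
    using integral_unif_indicator(1)[OF integrable_d assms] assms by (simp add: integral_d_eq)
qed

lemma integral_unif_d_1: "(LINT u|unif. d u) = 1"
proof -
  have "(LINT u|unif. d u) = (LINT u|unif. indicator {0<..1} u * d u)"
    by (intro Bochner_Integration.integral_cong) auto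
  then show ?thesis using integral_unif_d[of 0 1] by simp
qed

lemma dist_measure_eq_density:
  "dist_measure h = density lborel (\<lambda>u. ennreal (indicator {0<..<1} u * d u))"
proof -
  let ?H = "\<lambda>s. h (max 0 (min 1 s))"
  let ?N = "density lborel (\<lambda>u. ennreal (indicator {0<..<1} u * d u))"
  have Hm: "?H x \<le> ?H y" if "x \<le> y" for x y using that by (intro h_mono) auto
  have "continuous_on UNIV ?H"
    by (intro continuous_on_compose2[OF h_cont] continuous_intros) auto
  then have Hc: "continuous (at_right a) ?H" for a
    by (simp add: continuous_on_eq_continuous_within continuous_at_imp_continuous_at_within)
  have bot: "(?H \<longlongrightarrow> 0) at_bot"
    by (intro tendsto_eventually) (auto simp: eventually_at_bot_linorder intro!: exI[of _ 0])
  have top: "(?H \<longlongrightarrow> 1) at_top"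
    by (intro tendsto_eventually) (auto simp: eventually_at_top_linorder intro!: exI[of _ 1])
  have m: "(\<lambda>u. indicator {0<..<1} u * d u) \<in> borel_measurable lborel"
    using integrable_d by (simp add: integrable_unif_iff set_integrable_def)
  note [measurable] = m
  have em: "emeasure ?N {a<..b} = ennreal (?H b - ?H a)" if "a \<le> b" for a b
  proof -
    let ?a = "max 0 (min 1 a)" and ?b = "max 0 (min 1 b)"
    have "emeasure ?N {a<..b} = (\<integral>\<^sup>+u. ennreal (indicator {0<..<1} u * d u) * indicator {a<..b} u \<partial>lborel)"
      by (simp add: emeasure_density)
    also have "\<dots> = (\<integral>\<^sup>+u. ennreal (indicator {0<..<1} u * (indicator {?a<..?b} u * d u)) \<partial>lborel)"
      by (intro nn_integral_cong) (auto split: split_indicator)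
    also have "\<dots> = ennreal (LINT u|lborel. indicator {0<..<1} u * (indicator {?a<..?b} u * d u))"
    proof (rule nn_integral_eq_integral)
      have "integrable unif (\<lambda>u. indicator {?a<..?b} u * d u)"
        by (intro integrable_unif_indicator integrable_d) auto
      then show "integrable lborel (\<lambda>u. indicator {0<..<1} u * (indicator {?a<..?b} u * d u))"
        by (simp add: integrable_unif_iff set_integrable_def)
    qed (auto split: split_indicator simp: d_nonneg)
    also have "(LINT u|lborel. indicator {0<..<1} u * (indicator {?a<..?b} u * d u)) = ?H b - ?H a"
      using integral_unif_d[of ?a ?b] that by (simp add: integral_unif_eq set_lebesgue_integral_def)
    finally show ?thesis .
  qed
  show ?thesis unfolding dist_measure_def
  proof (rule measure_eqI_generator_eq[where \<Omega>=UNIV and E = "range (\<lambda>(a, b). {a<..b::real})" and A = "\<lambda>n. {- real n<..real n}"])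
    show "Int_stable (range (\<lambda>(a, b). {a<..b::real}))"
      by (auto simp: Int_stable_def)
    show "sets (interval_measure ?H) = sigma_sets UNIV (range (\<lambda>(a, b). {a<..b::real}))"
      "sets ?N = sigma_sets UNIV (range (\<lambda>(a, b). {a<..b::real}))"
      by (simp_all add: borel_sigma_sets_Ioc)
    fix X :: "real set" assume "X \<in> range (\<lambda>(a, b). {a<..b})"
    then obtain a b where X: "X = {a<..b}" by auto
    show "emeasure (interval_measure ?H) X = emeasure ?N X"
    proof (cases "a \<le> b")
      case True
      then show ?thesis using emeasure_interval_measure_Ioc[of a b ?H, OF True Hm Hc] em[OF True] X by simp
    qed (use X in simp)
  next
    show "(\<Union>n. {- real n<..real n}) = (UNIV :: real set)"
    proof (intro equalityI subsetI UNIV_I)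
      fix x :: real
      obtain n where "\<bar>x\<bar> < real n" using reals_Archimedean2 by blast
      then show "x \<in> (\<Union>n. {- real n<..real n})" by (auto intro!: exI[of _ n])
    qed
    show "emeasure (interval_measure ?H) {- real i<..real i} \<noteq> \<infinity>" for i
      using emeasure_interval_measure_Ioc[of "- real i" "real i" ?H, OF _ Hm Hc] by simp
  qed auto
qed


section \<open>Bounds for the distortion functional\<close>

lemma integrable_times_d:
  assumes "f \<in> borel_measurable unif" "AE u in unif. \<bar>f u\<bar> \<le> K"
  shows "integrable unif (\<lambda>u. f u * d u)"
proof (rule Bochner_Integration.integrable_bound)
  show "integrable unif (\<lambda>u. K * d u)" using integrable_d by simp
  show "(\<lambda>u. f u * d u) \<in> borel_measurable unif" using assms(1) by measurable
  show "AE u in unif. norm (f u * d u) \<le> norm (K * d u)"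
    using assms(2)
  proof eventually_elim
    case (elim u)
    then show ?case by (auto simp: abs_mult intro!: mult_right_mono)
  qed
qed

text \<open>The Value at Risk is the generalized inverse \<open>I\<close> of the distribution
  function from the Skorohod construction, which yields measurability and the law under
  \<open>unif\<close>.\<close>

lemma VaR_properties:
  assumes "prob_space M" and X [measurable]: "X \<in> borel_measurable M"
  shows "VaR M X \<in> borel_measurable unif"
    and "distr unif borel (VaR M X) = distr M borel X"
    and "dist_functional h M X = (LINT u|unif. VaR M X u * d u)"
proof -
  interpret M: prob_space M by fact
  interpret N: cdf_distribution "distr M borel X"
    by (intro cdf_distribution.intro M.real_distribution_distr X)
  have VaR: "VaR M X = N.I"
    by (auto simp: VaR_def cdf_def measure_distr vimage_def Int_def conj_commute fun_eq_iff
        intro!: arg_cong[where f = Inf])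
  show m [measurable]: "VaR M X \<in> borel_measurable unif"
    using N.measurable_CI unfolding VaR by (simp cong: measurable_cong_sets)
  show "distr unif borel (VaR M X) = distr M borel X"
    unfolding VaR by (rule N.distr_I_eq_M)
  have d1: "(\<lambda>u. indicator {0<..<1} u * d u) \<in> borel_measurable lborel"
    using integrable_d by (simp add: integrable_unif_iff set_integrable_def)
  \<comment> \<open>Level 1 belongs to the domain of \<open>dist_functional\<close> but not to
    \<open>unif\<close>; it is split off as a single point, where the density vanishes.\<close>
  have "(\<lambda>u. indicator {0<..1} u * VaR M X u) =
      (\<lambda>u. indicator {0<..<1} u *\<^sub>R VaR M X u + indicator {1} u * VaR M X 1)"
    by (auto simp: fun_eq_iff indicator_def)
  moreover have "(\<lambda>u. indicator {0<..<1} u *\<^sub>R VaR M X u) \<in> borel_measurable lborel"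
    using m by (subst (asm) borel_measurable_restrict_space_iff) auto
  ultimately have m2: "(\<lambda>u. indicator {0<..1} u * VaR M X u) \<in> borel_measurable lborel"
    by simp
  have "dist_functional h M X =
    (LINT u|lborel. (indicator {0<..<1} u * d u) *\<^sub>R (indicator {0<..1} u * VaR M X u))"
    unfolding dist_functional_def dist_measure_eq_density set_lebesgue_integral_def real_scaleR_def
    using d1 m2 by (subst integral_density) (auto split: split_indicator simp: d_nonneg)
  also have "\<dots> = (LINT u|unif. VaR M X u * d u)"
    unfolding integral_unif_eq set_lebesgue_integral_def
    by (intro Bochner_Integration.integral_cong) (auto split: split_indicator)
  finally show "dist_functional h M X = (LINT u|unif. VaR M X u * d u)" .
qed

lemma AE_abs_VaR_le:
  assumes "prob_space M" and X [measurable]: "X \<in> borel_measurable M"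
    and "AE \<omega> in M. \<bar>X \<omega>\<bar> \<le> K"
  shows "AE u in unif. \<bar>VaR M X u\<bar> \<le> K"
proof -
  have "AE y in distr M borel X. \<bar>y\<bar> \<le> K"
    using assms(3) by (subst AE_distr_iff) auto
  then show ?thesis
    using VaR_properties(1)[OF assms(1,2)]
    by (subst (asm) VaR_properties(2)[OF assms(1,2), symmetric], subst (asm) AE_distr_iff) auto
qed

text \<open>
  A Fenchel-Young argument: \<open>VaR M X u * d u \<le> \<Phi> (VaR M X u) + g u\<close> for the convex conjugate \<open>\<Phi>\<close>
  of \<open>g\<close> (shifted by \<open>C\<close> to be nonnegative), and \<open>VaR M X\<close> has the law of \<open>X\<close> under \<open>unif\<close>. This
  avoids the subadditivity of the distortion functional.
\<close>

lemma dist_functional_le: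
  assumes M: "prob_space M" and X [measurable]: "X \<in> borel_measurable M"
    and bound: "AE \<omega> in M. \<bar>X \<omega>\<bar> \<le> K"
    and a: "integrable M a" and g: "integrable unif g"
    and le: "AE \<omega> in M. \<forall>u\<in>{0<..<1}. X \<omega> * d u \<le> a \<omega> + g u"
  shows "dist_functional h M X \<le> (LINT \<omega>|M. a \<omega>) + (LINT u|unif. g u)"
proof -
  interpret M: prob_space M by fact
  \<comment> \<open>The value of \<open>a\<close> is bounded below through one fixed level, here
    1/2, together with the bound \<open>K\<close>; this makes \<open>a \<omega> + C\<close>
    nonnegative, as the integrals in \<open>ennreal\<close> require.\<close>
  define C where "C = K * d (1/2) + g (1/2)"
  define \<Phi> where "\<Phi> z = (SUP u\<in>{0<..<1}. ennreal (z * d u - g u + C))" for z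
  have aC: "AE \<omega> in M. 0 \<le> a \<omega> + C"
    using bound le
  proof eventually_elim
    case (elim \<omega>)
    then have "X \<omega> * d (1/2) \<le> a \<omega> + g (1/2)" by auto
    moreover have "- K * d (1/2) \<le> X \<omega> * d (1/2)"
      using elim d_nonneg[of "1/2"] by (intro mult_right_mono) auto
    ultimately show ?case by (simp add: C_def)
  qed
  \<comment> \<open>The supremum runs over uncountably many levels, but each function is continuous
    in z, so the sets where it exceeds y are open.\<close>
  have [measurable]: "\<Phi> \<in> borel_measurable borel"
  proof (rule borel_measurableI_greater)
    fix y
    have "{z \<in> space borel. y < \<Phi> z} = (\<Union>u\<in>{0<..<1}. {z. y < ennreal (z * d u - g u + C)})"
      by (auto simp: \<Phi>_def less_SUP_iff)
    also have "open \<dots>"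
      by (intro open_UN ballI open_Collect_less continuous_on_const
          continuous_on_ennreal continuous_intros)
    finally show "{z \<in> space borel. y < \<Phi> z} \<in> sets borel" by simp
  qed
  have [measurable]: "VaR M X \<in> borel_measurable unif" using VaR_properties(1)[OF M X] .
  have "(\<integral>\<^sup>+u. ennreal (VaR M X u * d u - g u + C) \<partial>unif) \<le> (\<integral>\<^sup>+u. \<Phi> (VaR M X u) \<partial>unif)"
    unfolding \<Phi>_def by (intro nn_integral_mono SUP_upper) auto
  also have "\<dots> = (\<integral>\<^sup>+y. \<Phi> y \<partial>distr unif borel (VaR M X))"
    by (intro nn_integral_distr[symmetric]) auto
  also have "\<dots> = (\<integral>\<^sup>+\<omega>. \<Phi> (X \<omega>) \<partial>M)"
    unfolding VaR_properties(2)[OF M X] by (intro nn_integral_distr) auto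
  also have "\<dots> \<le> (\<integral>\<^sup>+\<omega>. ennreal (a \<omega> + C) \<partial>M)"
  proof (intro nn_integral_mono_AE, use le in eventually_elim)
    case (elim \<omega>)
    then show ?case unfolding \<Phi>_def by (intro SUP_least ennreal_leI) (auto simp: algebra_simps)
  qed
  also have "\<dots> = ennreal ((LINT \<omega>|M. a \<omega>) + C)"
    using a aC by (subst nn_integral_eq_integral) (auto simp: M.prob_space)
  finally have nn: "(\<integral>\<^sup>+u. ennreal (VaR M X u * d u - g u + C) \<partial>unif) \<le> ennreal ((LINT \<omega>|M. a \<omega>) + C)" .
  have pos: "0 \<le> (LINT \<omega>|M. a \<omega>) + C"
    using integral_nonneg_AE[OF aC] a by (simp add: M.prob_space)
  have q: "integrable unif (\<lambda>u. VaR M X u * d u)"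
    by (rule integrable_times_d[OF _ AE_abs_VaR_le[OF M X bound]]) simp
  have "(LINT u|unif. VaR M X u * d u - g u + C) \<le> (LINT \<omega>|M. a \<omega>) + C"
  proof -
    \<comment> \<open>The integral is the positive part minus the negative part;
      \<open>ennreal\<close> keeps the former, and dropping the latter only increases the
      value.\<close>
    have "(LINT u|unif. VaR M X u * d u - g u + C)
      \<le> enn2real (\<integral>\<^sup>+u. ennreal (VaR M X u * d u - g u + C) \<partial>unif)"
      using q g by (subst real_lebesgue_integral_def) auto
    also have "\<dots> \<le> (LINT \<omega>|M. a \<omega>) + C"
      using nn pos by (intro enn2real_leI)
    finally show ?thesis .
  qed
  then show ?thesis
    using q g by (simp add: VaR_properties(3)[OF M X] unif.prob_space)
qed

text \<open>An increasing function of the level agrees with the quantile function of its law off its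
  countably many discontinuities. The lower bound suffices for attainment.\<close>

lemma dist_functional_comonotone_ge:
  assumes T [measurable]: "T \<in> measurable unif N" and X [measurable]: "X \<in> borel_measurable N"
    and mono: "mono_on {0<..<1} (\<lambda>u. X (T u))"
    and bound: "\<And>u. u \<in> {0<..<1} \<Longrightarrow> \<bar>X (T u)\<bar> \<le> K"
  shows "(LINT u|unif. X (T u) * d u) \<le> dist_functional h (distr unif N T) X"
proof -
  let ?M = "distr unif N T"
  have M: "prob_space ?M" by (intro unif.prob_space_distr T)
  have XM: "X \<in> borel_measurable ?M" by simp
  have bM: "AE \<omega> in ?M. \<bar>X \<omega>\<bar> \<le> K"
    using bound by (subst AE_distr_iff) auto
  let ?D = "{u\<in>{0<..<1}. \<not> isCont (\<lambda>u. X (T u)) u}"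
  have "countable ?D" by (intro mono_on_ctble_discont_open mono) auto
  then have "AE u in lborel. u \<notin> ?D"
    by (intro AE_not_in countable_imp_null_set_lborel)
  then have ae: "AE u in unif. isCont (\<lambda>u. X (T u)) u"
    unfolding AE_unif by auto
  have meas: "measure ?M {\<omega> \<in> space ?M. X \<omega> \<le> z} = measure unif {u \<in> {0<..<1}. X (T u) \<le> z}" for z
  proof -
    have "T -` {\<omega> \<in> space ?M. X \<omega> \<le> z} \<inter> space unif = {u \<in> {0<..<1}. X (T u) \<le> z}"
      using measurable_space[OF T] by auto
    then show ?thesis by (subst measure_distr) auto
  qed
  have le: "X (T u) \<le> VaR ?M X u" if u: "u \<in> {0<..<1}" and cont: "isCont (\<lambda>u. X (T u)) u" for u
    unfolding VaR_def
  proof (rule cInf_greatest)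
    have "{v \<in> {0<..<1}. X (T v) \<le> K} = space unif"
      using bound by (force simp: abs_le_iff)
    then have "measure unif {v \<in> {0<..<1}. X (T v) \<le> K} = 1"
      using unif.prob_space by simp
    then have "K \<in> {x. u \<le> measure ?M {\<omega> \<in> space ?M. X \<omega> \<le> x}}"
      unfolding mem_Collect_eq meas using u by simp
    then show "{x. u \<le> measure ?M {\<omega> \<in> space ?M. X \<omega> \<le> x}} \<noteq> {}" by blast
  next
    fix z assume "z \<in> {x. u \<le> measure ?M {\<omega> \<in> space ?M. X \<omega> \<le> x}}"
    then have z: "u \<le> measure unif {v \<in> {0<..<1}. X (T v) \<le> z}"
      unfolding mem_Collect_eq meas .
    \<comment> \<open>By monotonicity, a level v outside the sublevel set would confine that set to
      (0,v], whose mass v is less than u. Left continuity then transfers the bound from all v < u to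
      u.\<close>
    have below: "X (T v) \<le> z" if v: "v \<in> {0<..<u}" for v
    proof (rule ccontr)
      assume "\<not> X (T v) \<le> z"
      then have "{w \<in> {0<..<1}. X (T w) \<le> z} \<subseteq> {0<..v}"
        using mono v u by (fastforce simp: mono_on_def not_le)
      then have "measure unif {w \<in> {0<..<1}. X (T w) \<le> z} \<le> measure unif {0<..v}"
        using v u by (intro unif.finite_measure_mono) (auto simp: sets_restrict_space_iff)
      also have "\<dots> = v"
        using v u by (subst measure_restrict_space) auto
      finally show False using z v by auto
    qed
    have "((\<lambda>u. X (T u)) \<longlongrightarrow> X (T u)) (at_left u)"
      using cont by (auto simp: isCont_def intro: tendsto_within_subset)
    moreover have "\<forall>\<^sub>F v in at_left u. X (T v) \<le> z"
      using u below by (intro eventually_at_leftI[of 0]) auto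
    ultimately show "X (T u) \<le> z" by (rule tendsto_upperbound) simp
  qed
  show ?thesis unfolding VaR_properties(3)[OF M XM]
  proof (rule integral_mono_AE)
    show "integrable unif (\<lambda>u. X (T u) * d u)"
      using bound AE_space[of unif] by (intro integrable_times_d[of _ K]) auto
    show "integrable unif (\<lambda>u. VaR ?M X u * d u)"
      by (rule integrable_times_d[OF VaR_properties(1)[OF M XM] AE_abs_VaR_le[OF M XM bM]])
    show "AE u in unif. X (T u) * d u \<le> VaR ?M X u * d u"
      using ae AE_space[of unif] 
    proof eventually_elim
      case (elim u)
      then show ?case using le[of u] d_nonneg[of u] by (auto intro!: mult_right_mono)
    qed
  qed
qed

end

section \<open>Saddle points\<close>

lemma newsvendor_loss_measurable [measurable]: "newsvendor_loss p c x \<in> borel_measurable borel"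
  unfolding newsvendor_loss_def by measurable

lemma abs_newsvendor_loss_le:
  assumes "0 \<le> p" "0 \<le> c" "0 \<le> x" "0 \<le> y"
  shows "\<bar>newsvendor_loss p c x y\<bar> \<le> p * x + c * x"
proof -
  have "p * max (- y) (- x) \<le> 0" using assms by (intro mult_nonneg_nonpos) auto
  moreover have "p * (- x) \<le> p * max (- y) (- x)" using assms by (intro mult_left_mono) auto
  moreover have "0 \<le> c * x" "0 \<le> p * x" using assms by auto
  ultimately show ?thesis by (simp add: newsvendor_loss_def abs_le_iff)
qed

lemma newsvendor_loss_antimono:
  assumes "0 \<le> p" "y \<le> z"
  shows "newsvendor_loss p c x z \<le> newsvendor_loss p c x y"
  using assms by (auto simp: newsvendor_loss_def intro!: mult_left_mono)

lemma has_mean_std_square: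
  assumes "prob_space M" "has_mean_std M X m s"
  shows "(LINT \<omega>|M. (X \<omega>)\<^sup>2) = m\<^sup>2 + s\<^sup>2"
proof -
  interpret prob_space M by fact
  have X: "integrable M X" "integrable M (\<lambda>\<omega>. (X \<omega>)\<^sup>2)" "(LINT \<omega>|M. X \<omega>) = m"
    and s: "s\<^sup>2 = (LINT \<omega>|M. (X \<omega> - m)\<^sup>2)"
    using assms(2) by (auto simp: has_mean_std_def)
  show ?thesis unfolding s
    using X by (simp add: power2_diff prob_space mult.assoc mult.left_commute) (simp add: power2_eq_square)
qed

lemma has_mean_stdI:
  assumes "prob_space M" "integrable M X" "integrable M (\<lambda>\<omega>. (X \<omega>)\<^sup>2)"
    and "(LINT \<omega>|M. X \<omega>) = m" "(LINT \<omega>|M. (X \<omega>)\<^sup>2) = m\<^sup>2 + s\<^sup>2"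
  shows "has_mean_std M X m s"
proof -
  interpret prob_space M by fact
  have "(LINT \<omega>|M. (X \<omega> - m)\<^sup>2) = (LINT \<omega>|M. (X \<omega>)\<^sup>2) - 2 * m * (LINT \<omega>|M. X \<omega>) + m\<^sup>2"
    using assms by (simp add: power2_diff prob_space mult.assoc mult.left_commute)
  then show ?thesis using assms by (simp add: has_mean_std_def power2_eq_square)
qed

lemma has_mean_std_0_AE:
  assumes "prob_space M" "has_mean_std M X m 0"
  shows "AE \<omega> in M. X \<omega> = m"
proof -
  interpret prob_space M by fact
  have "integrable M (\<lambda>\<omega>. (X \<omega> - m)\<^sup>2)"
    using assms(2) by (simp add: has_mean_std_def power2_diff)
  then have "AE \<omega> in M. (X \<omega> - m)\<^sup>2 = 0"
    using assms(2) by (subst integral_nonneg_eq_0_iff_AE[symmetric]) (auto simp: has_mean_std_def)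
  then show ?thesis by simp
qed

context sq_distortion
begin

text \<open>
  The law of \<open>Y\<close> under the uniform distribution is a worst-case demand for the order quantity \<open>x\<close>.
  It is optimal because, at every level, \<open>Y u\<close> maximizes the weighted loss penalized by a
  quadratic whose mean is the same for all admissible demands. If \<open>s = 0\<close>, then no such
  quadratic need exist, but only the demand \<open>m\<close> is relevant.
\<close>

definition saddle_point ::
    "real \<Rightarrow> real \<Rightarrow> real \<Rightarrow> real \<Rightarrow> real \<Rightarrow> real \<Rightarrow> (real \<Rightarrow> real) \<Rightarrow> real \<Rightarrow> real \<Rightarrow> bool" where
  "saddle_point p c m s x v Y a b \<longleftrightarrow>
     0 < p \<and> 0 < c \<and> 0 \<le> x \<and>
     (\<forall>u w. 0 < u \<longrightarrow> u \<le> w \<longrightarrow> w < 1 \<longrightarrow> Y w \<le> Y u) \<and>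
     (\<forall>u. 0 < u \<longrightarrow> u < 1 \<longrightarrow> 0 \<le> Y u) \<and>
     has_mean_std unif Y m s \<and>
     (\<forall>x'\<ge>0. v \<le> (LINT u|unif. newsvendor_loss p c x' (Y u) * d u)) \<and>
     (LINT u|unif. newsvendor_loss p c x (Y u) * d u) = v \<and>
     (\<forall>u y. 0 < u \<longrightarrow> u < 1 \<longrightarrow> 0 \<le> y \<longrightarrow> (s = 0 \<longrightarrow> y = m) \<longrightarrow>
        newsvendor_loss p c x y * d u - (a * y\<^sup>2 + b * y)
          \<le> newsvendor_loss p c x (Y u) * d u - (a * (Y u)\<^sup>2 + b * Y u))"

lemma saddle_pointD:
  assumes "saddle_point p c m s x v Y a b"
  shows "0 < p" "0 < c" "0 \<le> x"
    and "0 < u \<Longrightarrow> u \<le> w \<Longrightarrow> w < 1 \<Longrightarrow> Y w \<le> Y u"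
    and "0 < u \<Longrightarrow> u < 1 \<Longrightarrow> 0 \<le> Y u"
    and "has_mean_std unif Y m s"
    and "0 \<le> x' \<Longrightarrow> v \<le> (LINT u|unif. newsvendor_loss p c x' (Y u) * d u)"
    and "(LINT u|unif. newsvendor_loss p c x (Y u) * d u) = v"
    and "0 < u \<Longrightarrow> u < 1 \<Longrightarrow> 0 \<le> y \<Longrightarrow> (s = 0 \<longrightarrow> y = m) \<Longrightarrow>
        newsvendor_loss p c x y * d u - (a * y\<^sup>2 + b * y)
          \<le> newsvendor_loss p c x (Y u) * d u - (a * (Y u)\<^sup>2 + b * Y u)"
  using assms unfolding saddle_point_def by blast+

lemma saddle_point_measurable:
  assumes "saddle_point p c m s x v Y a b"
  shows "Y \<in> borel_measurable unif"
  using saddle_pointD(6)[OF assms] by (auto simp: has_mean_std_def)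

lemma integrable_loss_times_d:
  assumes sp: "saddle_point p c m s x v Y a b" and "0 \<le> x'"
  shows "integrable unif (\<lambda>u. newsvendor_loss p c x' (Y u) * d u)"
proof (rule integrable_times_d)
  show "(\<lambda>u. newsvendor_loss p c x' (Y u)) \<in> borel_measurable unif"
    using saddle_point_measurable[OF sp] by measurable
  show "AE u in unif. \<bar>newsvendor_loss p c x' (Y u)\<bar> \<le> p * x' + c * x'"
    using AE_space[of unif]
  proof eventually_elim
    case (elim u)
    then show ?case
      using saddle_pointD(1,2)[OF sp] saddle_pointD(5)[OF sp, of u] assms(2)
      by (intro abs_newsvendor_loss_le) auto
  qed
qed

text \<open>The pointwise inequality of each product, rearranged, bounds the weighted loss by a
  function of the demand plus a function of the level, as \<open>dist_functional_le\<close> demands.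
  The penalties in \<open>A\<close> and in \<open>g\<close> have opposite means and cancel. The
  index set is arbitrary so that a single product, indexed by \<open>()\<close>, is an
  instance.\<close>

lemma dist_functional_sum_loss_le:
  fixes p c m s x v a b :: "'i \<Rightarrow> real"
  assumes M: "prob_space M" and I: "finite I"
    and sp: "\<And>i. i \<in> I \<Longrightarrow> saddle_point (p i) (c i) (m i) (s i) (x i) (v i) (Y i) (a i) (b i)"
    and X: "\<And>i. i \<in> I \<Longrightarrow> has_mean_std M (X i) (m i) (s i)"
    and pos: "\<And>i. i \<in> I \<Longrightarrow> AE \<omega> in M. 0 \<le> X i \<omega>"
  shows "dist_functional h M (\<lambda>\<omega>. \<Sum>i\<in>I. newsvendor_loss (p i) (c i) (x i) (X i \<omega>)) \<le> (\<Sum>i\<in>I. v i)"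
proof -
  interpret M: prob_space M by fact
  define A where "A \<omega> = (\<Sum>i\<in>I. a i * (X i \<omega>)\<^sup>2 + b i * X i \<omega>)" for \<omega>
  define g where "g u = (\<Sum>i\<in>I. newsvendor_loss (p i) (c i) (x i) (Y i u) * d u
    - (a i * (Y i u)\<^sup>2 + b i * Y i u))" for u
  have Xm [measurable]: "X i \<in> borel_measurable M" if "i \<in> I" for i
    using X[OF that] by (auto simp: has_mean_std_def)
  have posI: "AE \<omega> in M. \<forall>i\<in>I. 0 \<le> X i \<omega>"
    using I pos by (simp add: AE_finite_all)
  \<comment> \<open>For s = 0 the pointwise inequality is available at y = m alone, and a demand
    without variance almost surely takes no other value.\<close>
  have degenerate: "AE \<omega> in M. \<forall>i\<in>I. s i = 0 \<longrightarrow> X i \<omega> = m i"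
  proof (intro AE_finite_allI I)
    fix i assume i: "i \<in> I"
    show "AE \<omega> in M. s i = 0 \<longrightarrow> X i \<omega> = m i"
    proof (cases "s i = 0")
      case True
      then show ?thesis using has_mean_std_0_AE[OF M, of "X i" "m i"] X[OF i] by simp
    qed simp
  qed
  have "dist_functional h M (\<lambda>\<omega>. \<Sum>i\<in>I. newsvendor_loss (p i) (c i) (x i) (X i \<omega>))
    \<le> (LINT \<omega>|M. A \<omega>) + (LINT u|unif. g u)"
  proof (rule dist_functional_le[OF M])
    show "(\<lambda>\<omega>. \<Sum>i\<in>I. newsvendor_loss (p i) (c i) (x i) (X i \<omega>)) \<in> borel_measurable M"
      by measurable
    show "AE \<omega> in M. \<bar>\<Sum>i\<in>I. newsvendor_loss (p i) (c i) (x i) (X i \<omega>)\<bar> \<le> (\<Sum>i\<in>I. p i * x i + c i * x i)"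
      using posI
    proof eventually_elim
      case (elim \<omega>)
      have "\<bar>\<Sum>i\<in>I. newsvendor_loss (p i) (c i) (x i) (X i \<omega>)\<bar>
        \<le> (\<Sum>i\<in>I. \<bar>newsvendor_loss (p i) (c i) (x i) (X i \<omega>)\<bar>)" by (rule sum_abs)
      also have "\<dots> \<le> (\<Sum>i\<in>I. p i * x i + c i * x i)"
        using elim saddle_pointD(1-3)[OF sp]
        by (intro sum_mono abs_newsvendor_loss_le) (auto intro: less_imp_le)
      finally show ?case .
    qed
    show "integrable M A"
      unfolding A_def using X by (intro Bochner_Integration.integrable_sum) (auto simp: has_mean_std_def)
    show "integrable unif g"
      unfolding g_def
    proof (intro Bochner_Integration.integrable_sum Bochner_Integration.integrable_diff)
      fix i assume i: "i \<in> I"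
      show "integrable unif (\<lambda>u. newsvendor_loss (p i) (c i) (x i) (Y i u) * d u)"
        using integrable_loss_times_d[OF sp[OF i] saddle_pointD(3)[OF sp[OF i]]] .
      show "integrable unif (\<lambda>u. a i * (Y i u)\<^sup>2 + b i * Y i u)"
        using saddle_pointD(6)[OF sp[OF i]] by (auto simp: has_mean_std_def)
    qed
    show "AE \<omega> in M. \<forall>u\<in>{0<..<1}. (\<Sum>i\<in>I. newsvendor_loss (p i) (c i) (x i) (X i \<omega>)) * d u \<le> A \<omega> + g u"
      using posI degenerate
    proof eventually_elim
      case (elim \<omega>)
      show ?case
      proof
        fix u :: real assume u: "u \<in> {0<..<1}"
        have "(\<Sum>i\<in>I. newsvendor_loss (p i) (c i) (x i) (X i \<omega>) * d u)
          \<le> (\<Sum>i\<in>I. (a i * (X i \<omega>)\<^sup>2 + b i * X i \<omega>) + (newsvendor_loss (p i) (c i) (x i) (Y i u) * d u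
                - (a i * (Y i u)\<^sup>2 + b i * Y i u)))"
        proof (rule sum_mono)
          fix i assume i: "i \<in> I"
          show "newsvendor_loss (p i) (c i) (x i) (X i \<omega>) * d u
            \<le> (a i * (X i \<omega>)\<^sup>2 + b i * X i \<omega>) + (newsvendor_loss (p i) (c i) (x i) (Y i u) * d u
                - (a i * (Y i u)\<^sup>2 + b i * Y i u))"
            using saddle_pointD(9)[OF sp[OF i], of u "X i \<omega>"] u elim i by auto
        qed
        then show "(\<Sum>i\<in>I. newsvendor_loss (p i) (c i) (x i) (X i \<omega>)) * d u \<le> A \<omega> + g u"
          by (simp add: A_def g_def sum.distrib sum_distrib_right)
      qed
    qed
  qed
  also have "(LINT \<omega>|M. A \<omega>) = (\<Sum>i\<in>I. a i * ((m i)\<^sup>2 + (s i)\<^sup>2) + b i * m i)"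
    unfolding A_def
  proof (subst Bochner_Integration.integral_sum)
    show "(\<Sum>i\<in>I. LINT \<omega>|M. a i * (X i \<omega>)\<^sup>2 + b i * X i \<omega>) = (\<Sum>i\<in>I. a i * ((m i)\<^sup>2 + (s i)\<^sup>2) + b i * m i)"
    proof (rule sum.cong[OF refl])
      fix i assume i: "i \<in> I"
      show "(LINT \<omega>|M. a i * (X i \<omega>)\<^sup>2 + b i * X i \<omega>) = a i * ((m i)\<^sup>2 + (s i)\<^sup>2) + b i * m i"
        using has_mean_std_square[OF M X[OF i]] X[OF i] by (simp add: has_mean_std_def)
    qed
  qed (use X in \<open>auto simp: has_mean_std_def\<close>)
  also have "(LINT u|unif. g u) = (\<Sum>i\<in>I. v i - (a i * ((m i)\<^sup>2 + (s i)\<^sup>2) + b i * m i))"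
    unfolding g_def
  proof (subst Bochner_Integration.integral_sum)
    fix i assume i: "i \<in> I"
    have "integrable unif (\<lambda>u. newsvendor_loss (p i) (c i) (x i) (Y i u) * d u)"
      using integrable_loss_times_d[OF sp[OF i] saddle_pointD(3)[OF sp[OF i]]] .
    then show "integrable unif (\<lambda>u. newsvendor_loss (p i) (c i) (x i) (Y i u) * d u - (a i * (Y i u)\<^sup>2 + b i * Y i u))"
      using saddle_pointD(6)[OF sp[OF i]] by (auto simp: has_mean_std_def)
  next
    show "(\<Sum>i\<in>I. LINT u|unif. newsvendor_loss (p i) (c i) (x i) (Y i u) * d u - (a i * (Y i u)\<^sup>2 + b i * Y i u))
      = (\<Sum>i\<in>I. v i - (a i * ((m i)\<^sup>2 + (s i)\<^sup>2) + b i * m i))"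
    proof (rule sum.cong[OF refl])
      fix i assume i: "i \<in> I"
      have int: "integrable unif (\<lambda>u. newsvendor_loss (p i) (c i) (x i) (Y i u) * d u)"
        using integrable_loss_times_d[OF sp[OF i] saddle_pointD(3)[OF sp[OF i]]] .
      note ms = saddle_pointD(6)[OF sp[OF i]]
      show "(LINT u|unif. newsvendor_loss (p i) (c i) (x i) (Y i u) * d u - (a i * (Y i u)\<^sup>2 + b i * Y i u))
        = v i - (a i * ((m i)\<^sup>2 + (s i)\<^sup>2) + b i * m i)"
        using has_mean_std_square[OF prob_space_unif ms] ms int saddle_pointD(8)[OF sp[OF i]]
        by (simp add: has_mean_std_def)
    qed
  qed
  finally show ?thesis by (simp add: sum_subtractf)
qed

text \<open>All demands decrease in one common level and losses decrease in demand, so the total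
  loss increases with the level and its functional splits into the single-product integrals.
  \<open>T\<close> is the demand or the demand vector as a function of the level, and
  \<open>X i\<close> reads off a component.\<close>

lemma dist_functional_sum_loss_ge:
  fixes p c m s x v a b :: "'i \<Rightarrow> real"
  assumes I: "finite I"
    and sp: "\<And>i. i \<in> I \<Longrightarrow> saddle_point (p i) (c i) (m i) (s i) (x i) (v i) (Y i) (a i) (b i)"
    and T [measurable]: "T \<in> measurable unif N"
    and X [measurable]: "\<And>i. i \<in> I \<Longrightarrow> X i \<in> borel_measurable N"
    and XT: "\<And>i u. i \<in> I \<Longrightarrow> X i (T u) = Y i u"
    and x': "\<And>i. i \<in> I \<Longrightarrow> 0 \<le> x' i"
  shows "(\<Sum>i\<in>I. v i) \<le>
    dist_functional h (distr unif N T) (\<lambda>\<omega>. \<Sum>i\<in>I. newsvendor_loss (p i) (c i) (x' i) (X i \<omega>))"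
proof -
  let ?L = "\<lambda>\<omega>. \<Sum>i\<in>I. newsvendor_loss (p i) (c i) (x' i) (X i \<omega>)"
  have L: "?L (T u) = (\<Sum>i\<in>I. newsvendor_loss (p i) (c i) (x' i) (Y i u))" for u
    by (simp add: XT)
  have "(\<Sum>i\<in>I. v i) \<le> (\<Sum>i\<in>I. LINT u|unif. newsvendor_loss (p i) (c i) (x' i) (Y i u) * d u)"
    using saddle_pointD(7)[OF sp] x' by (intro sum_mono) auto
  also have "\<dots> = (LINT u|unif. ?L (T u) * d u)"
    unfolding L sum_distrib_right
    using integrable_loss_times_d[OF sp] x' by (subst Bochner_Integration.integral_sum) auto
  also have "\<dots> \<le> dist_functional h (distr unif N T) ?L"
  proof (rule dist_functional_comonotone_ge[OF T, where K = "\<Sum>i\<in>I. p i * x' i + c i * x' i"])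
    show "?L \<in> borel_measurable N" by measurable
    show "mono_on {0<..<1} (\<lambda>u. ?L (T u))"
      unfolding L mono_on_def
      using saddle_pointD(1)[OF sp] saddle_pointD(4)[OF sp]
      by (auto intro!: sum_mono newsvendor_loss_antimono intro: less_imp_le)
    fix u :: real assume u: "u \<in> {0<..<1}"
    have "\<bar>?L (T u)\<bar> \<le> (\<Sum>i\<in>I. \<bar>newsvendor_loss (p i) (c i) (x' i) (Y i u)\<bar>)"
      unfolding L by (rule sum_abs)
    also have "\<dots> \<le> (\<Sum>i\<in>I. p i * x' i + c i * x' i)"
      using u saddle_pointD(1,2)[OF sp] saddle_pointD(5)[OF sp] x'
      by (intro sum_mono abs_newsvendor_loss_le) (auto intro: less_imp_le)
    finally show "\<bar>?L (T u)\<bar> \<le> (\<Sum>i\<in>I. p i * x' i + c i * x' i)" .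
  qed
  finally show ?thesis .
qed

lemma has_mean_std_distr:
  assumes "T \<in> measurable M N" "X \<in> borel_measurable N"
  shows "has_mean_std (distr M N T) X m s \<longleftrightarrow> has_mean_std M (\<lambda>\<omega>. X (T \<omega>)) m s"
  using assms by (simp add: has_mean_std_def integrable_distr_eq integral_distr)

lemma worst_case_saddle_point:
  assumes sp: "saddle_point p c m s x v Y a b"
  shows "worst_case h p c m s x = ereal v" and "optimal_value h p c m s = ereal v"
proof -
  have le: "worst_case h p c m s x \<le> ereal v"
    unfolding worst_case_def
  proof (rule SUP_least)
    fix F assume F: "F \<in> demand_laws m s"
    then have "prob_space F" "has_mean_std F (\<lambda>y. y) m s" "AE y in F. 0 \<le> y"
      by (auto simp: demand_laws_def)
    then have "dist_functional h F (newsvendor_loss p c x) \<le> v"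
      using dist_functional_sum_loss_le[where M = F and I = "{()}" and v = "\<lambda>_. v" and p = "\<lambda>_. p"
        and c = "\<lambda>_. c" and m = "\<lambda>_. m" and s = "\<lambda>_. s" and x = "\<lambda>_. x" and Y = "\<lambda>_. Y"
        and a = "\<lambda>_. a" and b = "\<lambda>_. b" and X = "\<lambda>_ y. y"] sp by simp
    then show "ereal (dist_functional h F (newsvendor_loss p c x)) \<le> ereal v" by simp
  qed
  have ge: "ereal v \<le> worst_case h p c m s x'" if x': "0 \<le> x'" for x'
  proof -
    note [measurable] = saddle_point_measurable[OF sp]
    have "AE y in distr unif borel Y. 0 \<le> y"
      using saddle_pointD(5)[OF sp] by (subst AE_distr_iff) (auto intro!: AE_I2)
    then have "distr unif borel Y \<in> demand_laws m s"
      using saddle_pointD(6)[OF sp]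
      by (simp add: demand_laws_def has_mean_std_distr unif.prob_space_distr)
    moreover have "v \<le> dist_functional h (distr unif borel Y) (newsvendor_loss p c x')"
      using dist_functional_sum_loss_ge[where I = "{()}" and v = "\<lambda>_. v" and p = "\<lambda>_. p" and c = "\<lambda>_. c"
        and m = "\<lambda>_. m" and s = "\<lambda>_. s" and x = "\<lambda>_. x" and Y = "\<lambda>_. Y" and a = "\<lambda>_. a" and b = "\<lambda>_. b"
        and X = "\<lambda>_ y. y" and x' = "\<lambda>_. x'", OF _ sp saddle_point_measurable[OF sp]] x' by simp
    ultimately show ?thesis
      unfolding worst_case_def by (intro SUP_upper2[of "distr unif borel Y"]) simp_all
  qed
  show eq: "worst_case h p c m s x = ereal v"
    using le ge[OF saddle_pointD(3)[OF sp]] by (rule antisym)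
  show "optimal_value h p c m s = ereal v"
    unfolding optimal_value_def
  proof (rule antisym)
    show "(INF x\<in>{0..}. worst_case h p c m s x) \<le> ereal v"
      using eq saddle_pointD(3)[OF sp] by (intro INF_lower2[of x]) auto
    show "ereal v \<le> (INF x\<in>{0..}. worst_case h p c m s x)"
      using ge by (intro INF_greatest) auto
  qed
qed

lemma multi_worst_case_saddle_point:
  fixes p c m s x v :: "real ^ 'n"
  assumes sp: "\<And>i. saddle_point (p $ i) (c $ i) (m $ i) (s $ i) (x $ i) (v $ i) (Y i) (a i) (b i)"
  shows "multi_worst_case h p c m s x = ereal (\<Sum>i\<in>UNIV. v $ i)"
    and "multi_optimal_value h p c m s = ereal (\<Sum>i\<in>UNIV. v $ i)"
proof -
  let ?v = "ereal (\<Sum>i\<in>UNIV. v $ i)"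
  have le: "multi_worst_case h p c m s x \<le> ?v"
    unfolding multi_worst_case_def
  proof (rule SUP_least)
    fix F assume F: "F \<in> joint_demand_laws m s"
    then have F: "prob_space F" "\<And>i. has_mean_std F (\<lambda>S. S $ i) (m $ i) (s $ i)" "AE S in F. \<forall>i. 0 \<le> S $ i"
      by (auto simp: joint_demand_laws_def)
    have "dist_functional h F (\<lambda>S. \<Sum>i\<in>UNIV. newsvendor_loss (p $ i) (c $ i) (x $ i) (S $ i)) \<le> (\<Sum>i\<in>UNIV. v $ i)"
    proof (rule dist_functional_sum_loss_le[where Y = Y and a = a and b = b and m = "\<lambda>i. m $ i"
          and s = "\<lambda>i. s $ i" and p = "\<lambda>i. p $ i" and c = "\<lambda>i. c $ i" and x = "\<lambda>i. x $ i"
          and v = "\<lambda>i. v $ i" and X = "\<lambda>i S. S $ i"])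
      show "AE S in F. 0 \<le> S $ i" for i using F(3) by eventually_elim simp
    qed (use F sp in simp_all)
    then show "ereal (dist_functional h F (\<lambda>S. \<Sum>i\<in>UNIV. newsvendor_loss (p $ i) (c $ i) (x $ i) (S $ i))) \<le> ?v"
      by simp
  qed
  have ge: "?v \<le> multi_worst_case h p c m s x'" if x': "\<And>i. 0 \<le> x' $ i" for x'
  proof -
    let ?T = "\<lambda>u. \<chi> i. Y i u"
    have T [measurable]: "?T \<in> borel_measurable unif"
      using saddle_point_measurable[OF sp]
      by (subst borel_measurable_euclidean_space) (auto simp: Basis_vec_def inner_axis)
    have pr [measurable]: "(\<lambda>S :: real ^ 'n. S $ i) \<in> borel_measurable borel" for i
      by (intro borel_measurable_continuous_onI continuous_intros)
    have "AE S in distr unif borel ?T. \<forall>i. 0 \<le> S $ i"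
      using saddle_pointD(5)[OF sp] by (subst AE_distr_iff) (auto intro!: AE_I2)
    then have "distr unif borel ?T \<in> joint_demand_laws m s"
      using saddle_pointD(6)[OF sp]
      by (simp add: joint_demand_laws_def has_mean_std_distr unif.prob_space_distr)
    moreover have "(\<Sum>i\<in>UNIV. v $ i) \<le> dist_functional h (distr unif borel ?T)
        (\<lambda>S. \<Sum>i\<in>UNIV. newsvendor_loss (p $ i) (c $ i) (x' $ i) (S $ i))"
      by (rule dist_functional_sum_loss_ge[where Y = Y and a = a and b = b and m = "\<lambda>i. m $ i"
          and s = "\<lambda>i. s $ i" and p = "\<lambda>i. p $ i" and c = "\<lambda>i. c $ i" and x = "\<lambda>i. x $ i"
          and v = "\<lambda>i. v $ i" and x' = "\<lambda>i. x' $ i" and X = "\<lambda>i S. S $ i"])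
        (use sp x' in simp_all)
    ultimately show ?thesis
      unfolding multi_worst_case_def by (intro SUP_upper2[of "distr unif borel ?T"]) simp_all
  qed
  show eq: "multi_worst_case h p c m s x = ?v"
    using le ge[OF saddle_pointD(3)[OF sp]] by (rule antisym)
  show "multi_optimal_value h p c m s = ?v"
    unfolding multi_optimal_value_def
  proof (rule antisym)
    show "(INF x\<in>{x. \<forall>i. 0 \<le> x $ i}. multi_worst_case h p c m s x) \<le> ?v"
      using eq saddle_pointD(3)[OF sp] by (intro INF_lower2[of x]) auto
    show "?v \<le> (INF x\<in>{x. \<forall>i. 0 \<le> x $ i}. multi_worst_case h p c m s x)"
      using ge by (intro INF_greatest) auto
  qed
qed

end

section \<open>Truncated quantile functions\<close>

text \<open>
  The optimality of \<open>Y u\<close> at a level \<open>u\<close> above, respectively below, the critical level, where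
  \<open>b = B h'(u)\<close>, \<open>e = B \<tau>\<close>, and both sides have been multiplied by \<open>2 B / p\<close>.
\<close>

lemma penalty_minimal_above:
  fixes A b e y :: real
  assumes "0 \<le> e" "e \<le> b" "e \<le> A" "0 \<le> y"
  defines "x \<equiv> A - e / 2" and "Y \<equiv> max 0 (A - b)"
  shows "2 * b * min Y x + Y\<^sup>2 - 2 * A * Y \<le> 2 * b * min y x + y\<^sup>2 - 2 * A * y"
proof -
  have Y: "min Y x = Y" using assms by auto
  show ?thesis
  proof (cases "b \<le> A")
    case True
    then have YA: "Y = A - b" by (simp add: Y_def)
    \<comment> \<open>The right side exceeds the left by (y - (A - b))^2 if y \<le> x, and by (y -
      A)^2 + b (b - e) if y \<ge> x.\<close>
    have sq: "0 \<le> (y - (A - b))\<^sup>2" "0 \<le> (y - A)\<^sup>2" by auto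
    have "0 \<le> b * (b - e)" using assms by auto
    then show ?thesis
      using sq unfolding Y unfolding YA x_def
      by (cases "y \<le> A - e / 2") (auto simp: min_def power2_eq_square algebra_simps)
  next
    case False
    then have YA: "Y = 0" by (simp add: Y_def)
    \<comment> \<open>Now the left side is 0; the right side is y (2 (b - A) + y) if y \<le> x, and
      (y - A)^2 + A (b - A) + b (A - e) if y \<ge> x.\<close>
    have "0 \<le> A * (b - A)" "0 \<le> b * (A - e)" "0 \<le> (y - A)\<^sup>2" "0 \<le> y * (2 * (b - A) + y)"
      using assms False by auto
    then show ?thesis
      unfolding Y unfolding YA x_def
      by (cases "y \<le> A - e / 2") (auto simp: min_def power2_eq_square algebra_simps)
  qed
qed

lemma penalty_minimal_below:
  fixes A b e y :: real
  assumes "0 \<le> b" "b \<le> e"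
  defines "x \<equiv> A - e / 2"
  shows "2 * b * min A x + A\<^sup>2 - 2 * A * A \<le> 2 * b * min y x + y\<^sup>2 - 2 * A * y"
proof -
  have "min A x = x" using assms by auto
  moreover have "0 \<le> (y - (A - b))\<^sup>2" "0 \<le> (y - A)\<^sup>2" "0 \<le> b * (e - b)"
    using assms by auto
  ultimately show ?thesis
    unfolding x_def
    by (cases "y \<le> A - e / 2") (auto simp: min_def power2_eq_square algebra_simps)
qed

lemma newsvendor_loss_min: "newsvendor_loss p c x y = c * x - p * min y x"
  by (auto simp: newsvendor_loss_def min_def max_def)

lemma borel_measurable_unif_antimono:
  fixes Y :: "real \<Rightarrow> real"
  assumes "\<And>u w. 0 < u \<Longrightarrow> u \<le> w \<Longrightarrow> w < 1 \<Longrightarrow> Y w \<le> Y u"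
  shows "Y \<in> borel_measurable unif"
proof -
  have "mono_on {0<..<1} (\<lambda>u. - Y u)" using assms by (auto simp: mono_on_def)
  from borel_measurable_mono_on_fnc[OF this]
  have "(\<lambda>u. - (- Y u)) \<in> borel_measurable (restrict_space borel {0<..<1})"
    by (rule borel_measurable_uminus)
  then have "Y \<in> borel_measurable (restrict_space borel {0<..<1})" by (simp only: minus_minus)
  then show ?thesis by (simp only: measurable_cong_sets[OF sets_unif refl])
qed

lemma integral_unif_indicator_1:
  assumes "0 \<le> a" "a \<le> b" "b \<le> 1"
  shows "(LINT u|unif. indicator {a<..b} u :: real) = b - a"
  using integral_unif_indicator(1)[of "\<lambda>_. 1" a b] assms by simp

context sq_distortion
begin

lemma integrable_indicator_times:
  fixes f :: "real \<Rightarrow> real"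
  assumes "integrable unif f"
  shows "integrable unif (\<lambda>u. indicator {a<..b} u * f u)"
  using assms by (intro integrable_unif_indicator) auto

text \<open>The minimum of \<open>Y u\<close> and \<open>x\<close> is at most \<open>x\<close> below
  \<open>q\<close> and at most \<open>Y u\<close> above it. With these bounds the order quantity
  cancels: it enters as c x - p x h(q), which is 0 because h(q) = c / p. The bound is thus the same
  for every order quantity, and it is attained when \<open>Y\<close> crosses \<open>x\<close> at
  \<open>q\<close>.\<close>

lemma integral_loss_ge:
  assumes "0 < p" "0 \<le> q" "q \<le> 1" "h q = c / p" "0 \<le> x"
    and Y: "Y \<in> borel_measurable unif" "\<And>u. 0 < u \<Longrightarrow> u < 1 \<Longrightarrow> 0 \<le> Y u \<and> Y u \<le> K"
  defines "W \<equiv> (LINT u|unif. indicator {q<..1} u * (Y u * d u))"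
  shows "- p * W \<le> (LINT u|unif. newsvendor_loss p c x (Y u) * d u)"
    and "(\<And>u. 0 < u \<Longrightarrow> u \<le> q \<Longrightarrow> x \<le> Y u) \<Longrightarrow> (\<And>u. q < u \<Longrightarrow> u < 1 \<Longrightarrow> Y u \<le> x) \<Longrightarrow>
      (LINT u|unif. newsvendor_loss p c x (Y u) * d u) = - p * W"
proof -
  define f where "f u = c * x * d u - p * x * (indicator {0<..q} u * d u)
    - p * (indicator {q<..1} u * (Y u * d u))" for u
  have iY: "integrable unif (\<lambda>u. Y u * d u)"
    using Y by (intro integrable_times_d[where K = K] AE_I2) auto
  have if1: "integrable unif f"
    unfolding f_def using iY integrable_d
    by (intro Bochner_Integration.integrable_diff integrable_mult_right integrable_indicator_times)
  have "(LINT u|unif. f u) = c * x - p * x * h q - p * W"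
    unfolding f_def W_def using iY integrable_d assms(2,3)
    by (simp add: integrable_indicator_times integral_unif_d integral_unif_d_1)
  then have f: "(LINT u|unif. f u) = - p * W"
    using assms by simp
  have "(\<lambda>u. min (Y u) x) \<in> borel_measurable unif" using Y(1) by measurable
  then have "integrable unif (\<lambda>u. min (Y u) x * d u)"
    using Y(2) assms(5) by (intro integrable_times_d[where K = x] AE_I2) auto
  then have il: "integrable unif (\<lambda>u. newsvendor_loss p c x (Y u) * d u)"
    unfolding newsvendor_loss_min left_diff_distrib using integrable_d
    by (simp add: mult.assoc)
  have "f u \<le> newsvendor_loss p c x (Y u) * d u" if u: "0 < u" "u < 1" for u
  proof -
    have "c * x - p * (if u \<le> q then x else Y u) \<le> newsvendor_loss p c x (Y u)"
      unfolding newsvendor_loss_min using assms(1) by (auto intro!: mult_left_mono)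
    then have "(c * x - p * (if u \<le> q then x else Y u)) * d u \<le> newsvendor_loss p c x (Y u) * d u"
      using d_nonneg[OF u] by (rule mult_right_mono)
    moreover have "f u = (c * x - p * (if u \<le> q then x else Y u)) * d u"
      using u by (auto simp: f_def algebra_simps)
    ultimately show ?thesis by simp
  qed
  then show "- p * W \<le> (LINT u|unif. newsvendor_loss p c x (Y u) * d u)"
    unfolding f[symmetric] using if1 il by (intro integral_mono) auto
  assume *: "\<And>u. 0 < u \<Longrightarrow> u \<le> q \<Longrightarrow> x \<le> Y u" "\<And>u. q < u \<Longrightarrow> u < 1 \<Longrightarrow> Y u \<le> x"
  have "newsvendor_loss p c x (Y u) * d u = f u" if u: "0 < u" "u < 1" for u
    using u *(1)[of u] *(2)[of u] unfolding newsvendor_loss_min f_def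
    by (cases "u \<le> q") (auto simp: algebra_simps min_def)
  then show "(LINT u|unif. newsvendor_loss p c x (Y u) * d u) = - p * W"
    unfolding f[symmetric] by (intro Bochner_Integration.integral_cong) auto
qed

text \<open>The hypotheses \<open>below\<close> and \<open>above\<close> say that the positive part
  cuts off exactly at \<open>t\<close>, so the moments and the value reduce to integrals of
  \<open>d\<close> and its square over (q,t].\<close>

lemma saddle_point_truncated:
  assumes pc: "0 < p" "0 < c"
    and q: "0 < q" "q < t" "t \<le> 1" "h q = c / p"
    and B: "0 < B"
    and below: "\<And>u. 0 < u \<Longrightarrow> u < t \<Longrightarrow> B * d u \<le> A"
    and above: "\<And>u. t < u \<Longrightarrow> u < 1 \<Longrightarrow> A \<le> B * d u"
    and tau: "d q \<le> \<tau>" "\<And>u. q < u \<Longrightarrow> u < 1 \<Longrightarrow> \<tau> \<le> d u"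
  defines "D \<equiv> (LINT u|unif. indicator {q<..t} u * (d u)\<^sup>2)"
  assumes mean: "t * A - B * (h t - c / p) = m"
    and square: "t * A\<^sup>2 - 2 * A * B * (h t - c / p) + B\<^sup>2 * D = m\<^sup>2 + s\<^sup>2"
  shows "saddle_point p c m s (A - B * \<tau> / 2) (- p * (A * (h t - c / p) - B * D))
    (\<lambda>u. if u \<le> q then A else max 0 (A - B * d u)) (p / (2 * B)) (- p * A / B)"
proof -
  define x where "x = A - B * \<tau> / 2"
  define Y where "Y = (\<lambda>u. if u \<le> q then A else max 0 (A - B * d u))"
  have \<tau>0: "0 \<le> \<tau>" using tau(1) d_nonneg[of q] q by simp
  \<comment> \<open>A level strictly between \<open>q\<close> and \<open>t\<close> links the upper
    bound on \<tau> to \<open>below\<close>; this yields \<open>B * \<tau> \<le> A\<close> and hence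
    0 \<le> x \<le> A.\<close>
  obtain w where w: "q < w" "w < t" using q dense by blast
  have "B * \<tau> \<le> B * d w" using B tau(2)[of w] w q by simp
  also have "\<dots> \<le> A" using below[of w] w q by simp
  finally have \<tau>A: "B * \<tau> \<le> A" .
  have "0 \<le> B * \<tau>" using B \<tau>0 by simp
  then have A0: "0 \<le> A" and x0: "0 \<le> x" and xA: "x \<le> A" using \<tau>A by (auto simp: x_def)
  have anti: "Y w \<le> Y u" if "0 < u" "u \<le> w" "w < 1" for u w
  proof -
    have "B * d u \<le> B * d w" "0 \<le> B * d w" using B d_mono[OF that] d_nonneg[of w] that by auto
    then show ?thesis using that(2) A0 unfolding Y_def by (smt (verit))
  qed
  have Yb: "0 \<le> Y u \<and> Y u \<le> A" if "0 < u" "u < 1" for u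
    using that A0 B d_nonneg[of u] by (auto simp: Y_def)
  have Ym [measurable]: "Y \<in> borel_measurable unif"
    by (rule borel_measurable_unif_antimono[OF anti])
  have Ylow: "x \<le> Y u" if "u \<le> q" for u using that xA by (simp add: Y_def)
  have Yhigh: "Y u \<le> x" if u: "q < u" "u < 1" for u
  proof -
    have "B * \<tau> \<le> B * d u" using B tau(2)[OF u] by simp
    then show ?thesis using u x0 \<open>0 \<le> B * \<tau>\<close> by (auto simp: Y_def x_def)
  qed
  \<comment> \<open>At \<open>t\<close> itself the sign of \<open>A - B * d u\<close> is not known,
    so the formula is claimed off that point.\<close>
  have YAE: "AE u in unif. Y u = A * indicator {0<..t} u - B * (indicator {q<..t} u * d u)"
    using AE_space[of unif] AE_unif_neq[of t]
  proof eventually_elim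
    case (elim u)
    then consider "u \<le> q" | "q < u" "u < t" | "t < u" by force
    then show ?case
      using elim q below[of u] above[of u] by cases (auto simp: Y_def)
  qed
  have YAE2: "AE u in unif. (Y u)\<^sup>2 = A\<^sup>2 * indicator {0<..t} u - 2 * A * B * (indicator {q<..t} u * d u)
      + B\<^sup>2 * (indicator {q<..t} u * (d u)\<^sup>2)"
    using YAE AE_space[of unif]
  proof eventually_elim
    case (elim u)
    then show ?case using q by (auto simp: indicator_def power2_eq_square algebra_simps)
  qed
  have one: "integrable unif (\<lambda>u. indicator {0<..t} u :: real)"
    using integrable_indicator_times[of "\<lambda>_. 1" 0 t] by simp
  note ints = one integrable_indicator_times[OF integrable_d] integrable_indicator_times[OF integrable_d2]
  have iY: "integrable unif Y" 
    by (rule integrable_cong_AE_imp[OF _ Ym AE_symmetric[OF YAE]]) (use ints in simp)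
  have iY2: "integrable unif (\<lambda>u. (Y u)\<^sup>2)" 
    by (rule integrable_cong_AE_imp[OF _ _ AE_symmetric[OF YAE2]]) (use ints in simp_all)
  have hm: "has_mean_std unif Y m s"
  proof (rule has_mean_stdI[OF prob_space_unif iY iY2])
    have "(LINT u|unif. Y u) = (LINT u|unif. A * indicator {0<..t} u - B * (indicator {q<..t} u * d u))"
      using YAE ints by (intro integral_cong_AE) auto
    also have "\<dots> = t * A - B * (h t - c / p)"
      using ints q integral_unif_indicator_1[of 0 t] by (simp add: integral_unif_d)
    finally show "(LINT u|unif. Y u) = m" using mean by simp
    have "(LINT u|unif. (Y u)\<^sup>2) = (LINT u|unif. A\<^sup>2 * indicator {0<..t} u
        - 2 * A * B * (indicator {q<..t} u * d u) + B\<^sup>2 * (indicator {q<..t} u * (d u)\<^sup>2))"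
      using YAE2 ints by (intro integral_cong_AE) auto
    also have "\<dots> = t * A\<^sup>2 - 2 * A * B * (h t - c / p) + B\<^sup>2 * D"
      using ints q integral_unif_indicator_1[of 0 t] by (simp add: integral_unif_d D_def)
    finally show "(LINT u|unif. (Y u)\<^sup>2) = m\<^sup>2 + s\<^sup>2" using square by simp
  qed
  have W: "(LINT u|unif. indicator {q<..1} u * (Y u * d u)) = A * (h t - c / p) - B * D"
  proof -
    have "AE u in unif. indicator {q<..1} u * (Y u * d u)
      = A * (indicator {q<..t} u * d u) - B * (indicator {q<..t} u * (d u)\<^sup>2)"
      using YAE AE_space[of unif]
    proof eventually_elim
      case (elim u)
      then show ?case using q by (auto simp: indicator_def power2_eq_square algebra_simps)
    qed
    then have "(LINT u|unif. indicator {q<..1} u * (Y u * d u))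
      = (LINT u|unif. A * (indicator {q<..t} u * d u) - B * (indicator {q<..t} u * (d u)\<^sup>2))"
    proof (rule integral_cong_AE[rotated 2])
      have "integrable unif (\<lambda>u. indicator {q<..1} u * (Y u * d u))"
        using Yb by (intro integrable_indicator_times integrable_times_d[where K = A] AE_I2) auto
      then show "(\<lambda>u. indicator {q<..1} u * (Y u * d u)) \<in> borel_measurable unif" by simp
    qed (use ints in auto)
    then show ?thesis using ints q by (simp add: integral_unif_d D_def)
  qed
  note loss = integral_loss_ge[where Y = Y and K = A and p = p and c = c and q = q, OF pc(1) _ _ q(4) _ Ym Yb]
  have key: "newsvendor_loss p c x y * d u - (p / (2 * B) * y\<^sup>2 + - p * A / B * y)
      \<le> newsvendor_loss p c x (Y u) * d u - (p / (2 * B) * (Y u)\<^sup>2 + - p * A / B * Y u)"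
    if u: "0 < u" "u < 1" and y: "0 \<le> y" for u y
  proof -
    have "2 * (B * d u) * min (Y u) x + (Y u)\<^sup>2 - 2 * A * Y u \<le> 2 * (B * d u) * min y x + y\<^sup>2 - 2 * A * y"
    proof (cases "u \<le> q")
      case True
      have "d u \<le> \<tau>" using d_mono[of u q] u True tau(1) q by simp
      then have "B * d u \<le> B * \<tau>" "0 \<le> B * d u" using B d_nonneg[OF u] by auto
      then show ?thesis
        using penalty_minimal_below[of "B * d u" "B * \<tau>" A y] True
        by (simp add: x_def Y_def power2_eq_square)
    next
      case False
      then have "B * \<tau> \<le> B * d u" using tau(2)[of u] u B by simp
      then show ?thesis
        using penalty_minimal_above[of "B * \<tau>" "B * d u" A y] False \<tau>A y \<open>0 \<le> B * \<tau>\<close>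
        by (simp add: x_def Y_def)
    qed
    then have "p / (2 * B) * (2 * (B * d u) * min (Y u) x + (Y u)\<^sup>2 - 2 * A * Y u)
        \<le> p / (2 * B) * (2 * (B * d u) * min y x + y\<^sup>2 - 2 * A * y)"
      using pc B by (intro mult_left_mono) auto
    moreover have "newsvendor_loss p c x z * d u - (p / (2 * B) * z\<^sup>2 + - p * A / B * z)
        = c * x * d u - p / (2 * B) * (2 * (B * d u) * min z x + z\<^sup>2 - 2 * A * z)" for z
      unfolding newsvendor_loss_min using B by (simp add: field_simps)
    ultimately show ?thesis by simp
  qed
  have "saddle_point p c m s x (- p * (A * (h t - c / p) - B * D)) Y (p / (2 * B)) (- p * A / B)"
    unfolding saddle_point_def
  proof (intro conjI allI impI pc x0 hm)
    show "(LINT u|unif. newsvendor_loss p c x (Y u) * d u) = - p * (A * (h t - c / p) - B * D)"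
      using loss(2)[of x] q x0 Ylow Yhigh unfolding W by simp
    show "- p * (A * (h t - c / p) - B * D) \<le> (LINT u|unif. newsvendor_loss p c x' (Y u) * d u)"
      if "0 \<le> x'" for x'
      using loss(1)[of x'] q that unfolding W by simp
  qed (use anti Yb key in blast)+
  then show ?thesis unfolding x_def Y_def .
qed

text \<open>Without variance the coefficient B is 0 at t = 1 and p / (2B) has no meaning. Since the
  pointwise condition is required only at y = m, the zero penalty serves.\<close>

lemma saddle_point_deterministic:
  assumes "0 < p" "0 < c" "c < p" "0 \<le> m"
  shows "saddle_point p c m 0 m (- m * (p - c)) (\<lambda>_. m) 0 0"
proof -
  have "has_mean_std unif (\<lambda>_. m) m 0" by (simp add: has_mean_std_def)
  moreover have "- m * (p - c) \<le> newsvendor_loss p c x' m" if "0 \<le> x'" for x'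
  proof (cases "x' \<le> m")
    case True
    then have "x' * (p - c) \<le> m * (p - c)" using assms by (intro mult_right_mono) auto
    then show ?thesis using True by (simp add: newsvendor_loss_min algebra_simps)
  next
    case False
    then have "c * m \<le> c * x'" using assms by (intro mult_left_mono) auto
    then show ?thesis using False by (simp add: newsvendor_loss_min algebra_simps)
  qed
  moreover have "newsvendor_loss p c m m = - m * (p - c)"
    by (simp add: newsvendor_loss_min algebra_simps)
  ultimately show ?thesis
    using assms by (simp add: saddle_point_def integral_unif_d_1)
qed

text \<open>The worst-case demand takes two values, m / t with probability t and 0 otherwise. As t
  \<le> q, no demand is left above the critical level, so the bound in
  \<open>integral_loss_ge\<close> is 0, which the empty order attains.\<close>

lemma saddle_point_no_order:
  assumes pc: "0 < p" "0 < c" and q: "0 \<le> q" "q \<le> 1" "h q = c / p"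
    and t: "0 < t" "t \<le> q" and m: "0 \<le> m" "m\<^sup>2 / t = m\<^sup>2 + s\<^sup>2"
  shows "saddle_point p c m s 0 0 (\<lambda>u. m / t * indicator {0<..t} u) 0 0"
proof -
  define Y where "Y u = m / t * indicator {0<..t} u" for u :: real
  have anti: "Y w \<le> Y u" if "0 < u" "u \<le> w" "w < 1" for u w
    using that m t by (auto simp: Y_def indicator_def)
  have Yb: "0 \<le> Y u \<and> Y u \<le> m / t" if "0 < u" "u < 1" for u
    using that m t by (auto simp: Y_def indicator_def)
  have one: "integrable unif (\<lambda>u. indicator {0<..t} u :: real)"
    using integrable_indicator_times[of "\<lambda>_. 1" 0 t] by simp
  have sq: "(Y u)\<^sup>2 = (m / t)\<^sup>2 * indicator {0<..t} u" for u
    by (auto simp: Y_def indicator_def)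
  have "has_mean_std unif Y m s"
  proof (rule has_mean_stdI[OF prob_space_unif])
    show "integrable unif Y" "integrable unif (\<lambda>u. (Y u)\<^sup>2)"
      unfolding sq using one by (simp_all add: Y_def[abs_def])
    show "(LINT u|unif. Y u) = m" "(LINT u|unif. (Y u)\<^sup>2) = m\<^sup>2 + s\<^sup>2"
      unfolding sq m(2)[symmetric] using integral_unif_indicator_1[of 0 t] q t
      by (simp_all add: Y_def power2_eq_square)
  qed
  moreover have "0 \<le> (LINT u|unif. newsvendor_loss p c x' (Y u) * d u)" if "0 \<le> x'" for x'
  proof -
    have "(\<lambda>u. indicator {q<..1} u * (Y u * d u)) = (\<lambda>_. 0)"
      using t by (auto simp: Y_def indicator_def)
    then have W: "(LINT u|unif. indicator {q<..1} u * (Y u * d u)) = 0" by (simp only: integral_zero)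
    have Ym: "Y \<in> borel_measurable unif" by (rule borel_measurable_unif_antimono[OF anti])
    show ?thesis
      using integral_loss_ge(1)[OF pc(1) q that Ym Yb] unfolding W by simp
  qed
  moreover have "newsvendor_loss p c 0 y = 0" if "0 \<le> y" for y
    using that by (simp add: newsvendor_loss_min)
  moreover have "(LINT u|unif. newsvendor_loss p c 0 (Y u) * d u) = (LINT u|unif. 0)"
    using Yb by (intro Bochner_Integration.integral_cong) (auto simp: newsvendor_loss_min)
  ultimately have "saddle_point p c m s 0 0 Y 0 0"
    unfolding saddle_point_def using pc anti Yb by simp
  then show ?thesis by (simp add: Y_def[abs_def])
qed

end

section \<open>The closed-form solution\<close>

lemma truncated_level_sq:
  fixes m s t H D \<kappa> :: real
  assumes "m \<noteq> 0"
  shows "m\<^sup>2 * (t * D - H\<^sup>2) - (t * (m\<^sup>2 + s\<^sup>2) - m\<^sup>2) * (t * \<kappa> - H)\<^sup>2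
    = - (t * m\<^sup>2) * ((1 + (s / m)\<^sup>2) * (t * \<kappa> - H)\<^sup>2 - (\<kappa>\<^sup>2 * t - 2 * \<kappa> * H + D))"
proof -
  define X where "X = (t * \<kappa> - H)\<^sup>2"
  define Z where "Z = \<kappa>\<^sup>2 * t - 2 * \<kappa> * H + D"
  have "m\<^sup>2 * (1 + (s / m)\<^sup>2) = m\<^sup>2 + s\<^sup>2" using assms by (simp add: field_simps)
  then have "t * m\<^sup>2 * ((1 + (s / m)\<^sup>2) * X) = t * (m\<^sup>2 + s\<^sup>2) * X"
    by (metis mult.assoc)
  moreover have "m\<^sup>2 * (t * D - H\<^sup>2) + m\<^sup>2 * X = t * m\<^sup>2 * Z"
    by (simp add: X_def Z_def power2_eq_square algebra_simps)
  moreover have "(t * (m\<^sup>2 + s\<^sup>2) - m\<^sup>2) * X = t * (m\<^sup>2 + s\<^sup>2) * X - m\<^sup>2 * X"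
    by (rule left_diff_distrib)
  moreover have "- (t * m\<^sup>2) * ((1 + (s / m)\<^sup>2) * X - Z) = t * m\<^sup>2 * Z - t * m\<^sup>2 * ((1 + (s / m)\<^sup>2) * X)"
    by (simp only: minus_mult_left[symmetric] right_diff_distrib minus_diff_eq)
  ultimately show ?thesis unfolding X_def[symmetric] Z_def[symmetric] by linarith
qed

text \<open>
  With \<open>H = \<integral> w\<close> and \<open>D = \<integral> w\<^sup>2\<close> over \<open>[0,t]\<close>, these are the coefficients \<open>B\<close> and \<open>A\<close> for which
  \<open>A - B w\<close> on \<open>[0,t]\<close> has mean \<open>m\<close> and second moment \<open>m\<^sup>2 + s\<^sup>2\<close>.
\<close>

definition trunc_slope :: "real \<Rightarrow> real \<Rightarrow> real \<Rightarrow> real \<Rightarrow> real \<Rightarrow> real" where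
  "trunc_slope m s t H D = sigma_trunc m s t / sqrt (t * D - H\<^sup>2)"

definition trunc_intercept :: "real \<Rightarrow> real \<Rightarrow> real \<Rightarrow> real \<Rightarrow> real \<Rightarrow> real" where
  "trunc_intercept m s t H D = (m + trunc_slope m s t H D * H) / t"

text \<open>After clearing denominators the left side reads S (t \<kappa> - H) \<le> m \<Delta>,
  with both sides nonnegative; squaring turns it into the feasibility inequality. So feasibility
  means that the untruncated demand A - B w is still nonnegative where w has the value
  \<kappa>.\<close>

lemma trunc_slope_le_intercept_iff:
  fixes m s t H D \<kappa> :: real
  assumes m: "0 < m" and t: "0 < t" "m\<^sup>2 \<le> t * (m\<^sup>2 + s\<^sup>2)" and D: "H\<^sup>2 < t * D" and H: "H \<le> t * \<kappa>"
  shows "trunc_slope m s t H D * \<kappa> \<le> trunc_intercept m s t H D \<longleftrightarrow>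
    (1 + (s / m)\<^sup>2) * (t * \<kappa> - H)\<^sup>2 - (\<kappa>\<^sup>2 * t - 2 * \<kappa> * H + D) \<le> 0"
proof -
  define \<Delta> where "\<Delta> = sqrt (t * D - H\<^sup>2)"
  define S where "S = sigma_trunc m s t"
  have \<Delta>: "0 < \<Delta>" "\<Delta>\<^sup>2 = t * D - H\<^sup>2" using D by (auto simp: \<Delta>_def)
  have S: "0 \<le> S" "S\<^sup>2 = t * (m\<^sup>2 + s\<^sup>2) - m\<^sup>2" using t by (auto simp: S_def sigma_trunc_def)
  have "trunc_slope m s t H D * \<kappa> \<le> trunc_intercept m s t H D \<longleftrightarrow> S * (t * \<kappa> - H) \<le> m * \<Delta>"
    unfolding trunc_slope_def trunc_intercept_def \<Delta>_def[symmetric] S_def[symmetric]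
    using t \<Delta> by (simp add: field_simps)
  also have "\<dots> \<longleftrightarrow> (S * (t * \<kappa> - H))\<^sup>2 \<le> (m * \<Delta>)\<^sup>2"
    using m \<Delta> S H by (intro power_mono_iff[symmetric]) auto
  also have "\<dots> \<longleftrightarrow> 0 \<le> m\<^sup>2 * (t * D - H\<^sup>2) - (t * (m\<^sup>2 + s\<^sup>2) - m\<^sup>2) * (t * \<kappa> - H)\<^sup>2"
    by (simp add: power_mult_distrib \<Delta> S)
  also have "\<dots> \<longleftrightarrow> (1 + (s / m)\<^sup>2) * (t * \<kappa> - H)\<^sup>2 - (\<kappa>\<^sup>2 * t - 2 * \<kappa> * H + D) \<le> 0"
    using m t by (subst truncated_level_sq) (auto simp: mult_le_0_iff zero_le_mult_iff)
  finally show ?thesis .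
qed

lemma trunc_moments:
  fixes m s t H D :: real
  assumes t: "0 < t" "m\<^sup>2 \<le> t * (m\<^sup>2 + s\<^sup>2)" and D: "H\<^sup>2 < t * D"
  defines "A \<equiv> trunc_intercept m s t H D" and "B \<equiv> trunc_slope m s t H D"
  shows "t * A - B * H = m"
    and "t * A\<^sup>2 - 2 * A * B * H + B\<^sup>2 * D = m\<^sup>2 + s\<^sup>2"
    and "A * H - B * D = (m * H - sigma_trunc m s t * sqrt (t * D - H\<^sup>2)) / t"
    and "A - B * \<tau> / 2 = m / t - sigma_trunc m s t / t * ((t * \<tau> - 2 * H) / (2 * sqrt (t * D - H\<^sup>2)))"
proof -
  define \<Delta> where "\<Delta> = sqrt (t * D - H\<^sup>2)"
  define S where "S = sigma_trunc m s t"
  have \<Delta>: "0 < \<Delta>" "\<Delta>\<^sup>2 = t * D - H\<^sup>2" using D by (auto simp: \<Delta>_def)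
  have S: "S\<^sup>2 = t * (m\<^sup>2 + s\<^sup>2) - m\<^sup>2" using t by (auto simp: S_def sigma_trunc_def)
  have B: "B = S / \<Delta>" by (simp add: B_def trunc_slope_def S_def \<Delta>_def)
  then have B\<Delta>: "B * \<Delta> = S" using \<Delta> by simp
  have "t * A = m + B * H"
    using t by (simp add: A_def B_def trunc_intercept_def)
  then show mean: "t * A - B * H = m" by simp
  \<comment> \<open>The second moment times t is the squared mean plus B^2 (t D - H^2); the choice
    \<open>B * \<Delta> = S\<close> makes the latter equal to the prescribed remainder.\<close>
  have "t * (t * A\<^sup>2 - 2 * A * B * H + B\<^sup>2 * D) = (t * A - B * H)\<^sup>2 + B\<^sup>2 * (t * D - H\<^sup>2)"
    by (simp add: power2_eq_square algebra_simps)
  also have "\<dots> = t * (m\<^sup>2 + s\<^sup>2)"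
    unfolding mean \<Delta>(2)[symmetric] power_mult_distrib[symmetric] B\<Delta> S by simp
  finally show "t * A\<^sup>2 - 2 * A * B * H + B\<^sup>2 * D = m\<^sup>2 + s\<^sup>2" using t by simp
  have "t * (A * H) = (m + B * H) * H"
    using \<open>t * A = m + B * H\<close> by (metis mult.assoc)
  then have "t * (A * H - B * D) = m * H - B * \<Delta>\<^sup>2"
    unfolding \<Delta>(2) by (simp add: power2_eq_square algebra_simps)
  also have "\<dots> = m * H - S * \<Delta>" using B\<Delta> by (simp add: power2_eq_square)
  finally show "A * H - B * D = (m * H - sigma_trunc m s t * sqrt (t * D - H\<^sup>2)) / t"
    using t by (simp add: S_def \<Delta>_def field_simps)
  have "A = (m + B * H) / t" using t \<open>t * A = m + B * H\<close> by (simp add: field_simps)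
  then show "A - B * \<tau> / 2 = m / t - sigma_trunc m s t / t * ((t * \<tau> - 2 * H) / (2 * sqrt (t * D - H\<^sup>2)))"
    unfolding \<Delta>_def[symmetric] S_def[symmetric] B using t \<Delta> by (simp add: field_simps)
qed

context sq_distortion
begin

lemma crit_level:
  assumes "0 < \<beta>" "\<beta> < 1"
  shows "0 < crit_level h \<beta>" "crit_level h \<beta> < 1" "h (crit_level h \<beta>) = \<beta>"
proof -
  have "\<exists>x\<ge>0. x \<le> 1 \<and> h x = \<beta>"
    using h_cont assms by (intro IVT') auto
  then have "\<beta> \<in> h ` {0..1}" by auto
  then have "crit_level h \<beta> \<in> {0..1}" and eq: "h (crit_level h \<beta>) = \<beta>"
    unfolding crit_level_def by (auto intro: inv_into_into f_inv_into_f simp del: atLeastAtMost_iff)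
  moreover have "crit_level h \<beta> \<noteq> 0" "crit_level h \<beta> \<noteq> 1"
    using eq assms by (metis h0 less_irrefl, metis h1 less_irrefl)
  ultimately show "0 < crit_level h \<beta>" "crit_level h \<beta> < 1" "h (crit_level h \<beta>) = \<beta>"
    by auto
qed

end

section \<open>Feasibility of truncation levels above the critical level\<close>

locale sq_distortion_level = sq_distortion +
  fixes \<beta> :: real
  assumes beta: "0 < \<beta>" "\<beta> < 1"
begin

definition q :: real where "q = crit_level h \<beta>"

lemma q: "0 < q" "q < 1" "h q = \<beta>"
  using crit_level[OF beta] by (auto simp: q_def)

definition D :: "real \<Rightarrow> real" where "D t = integral {q..t} (\<lambda>u. (d u)\<^sup>2)"

lemma D_eq:
  assumes "q \<le> t" "t \<le> 1"
  shows "(LINT u|unif. indicator {q<..t} u * (d u)\<^sup>2) = D t"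
    and "(LBINT u:{q..t}. (d u)\<^sup>2) = D t"
  using integral_unif_indicator(1,2)[OF integrable_d2, of q t] assms q by (auto simp: D_def)

lemma Delta_eq: "q \<le> t \<Longrightarrow> t \<le> 1 \<Longrightarrow> Delta h \<beta> t = sqrt (t * D t - (h t - \<beta>)\<^sup>2)"
  using D_eq(2)[of t] by (simp add: Delta_def q_def d_def)

lemma D_cont: "continuous_on {q..1} D"
proof -
  have "(\<lambda>u. (d u)\<^sup>2) integrable_on {0..1}"
    using integral_unif_indicator(3)[OF integrable_d2, of 0 0] by simp
  then have "(\<lambda>u. (d u)\<^sup>2) integrable_on {q..1}"
    by (rule integrable_on_subinterval) (use q in auto)
  then show ?thesis
    unfolding D_def by (rule indefinite_integral_continuous_1)
qed

lemma h_gt_beta: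
  assumes "q < t" "t \<le> 1"
  shows "\<beta> < h t"
proof -
  have "0 < slope 0 q" using q beta by (simp add: slope_def)
  also have "\<dots> \<le> slope q t" using assms q by (intro slope_mono) auto
  finally show ?thesis using assms q by (simp add: slope_def zero_less_divide_iff)
qed

text \<open>Cauchy-Schwarz on (q,t], with \<open>k\<close> the mean of \<open>d\<close> there, gives
  H^2 \<le> (t - q) D. Strictness comes from q > 0 and D > 0, and it makes \<open>Delta\<close> a
  legitimate denominator.\<close>

lemma sq_H_less:
  assumes "q < t" "t \<le> 1"
  shows "(h t - \<beta>)\<^sup>2 < t * D t"
proof -
  define k where "k = (h t - \<beta>) / (t - q)"
  have H: "0 < h t - \<beta>" using h_gt_beta[OF assms] by simp
  note ints = integrable_indicator_times[OF integrable_d, of q t] integrable_indicator_times[OF integrable_d2, of q t]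
    integrable_indicator_times[of "\<lambda>_. 1" q t, simplified]
  have "0 \<le> (LINT u|unif. indicator {q<..t} u * (d u - k)\<^sup>2)"
    by (intro Bochner_Integration.integral_nonneg) auto
  also have "\<dots> = (LINT u|unif. indicator {q<..t} u * (d u)\<^sup>2 - 2 * k * (indicator {q<..t} u * d u)
      + k\<^sup>2 * indicator {q<..t} u)"
    by (intro Bochner_Integration.integral_cong) (auto simp: power2_eq_square algebra_simps indicator_def)
  also have "\<dots> = D t - 2 * k * (h t - \<beta>) + k\<^sup>2 * (t - q)"
    using ints assms q integral_unif_indicator_1[of q t] D_eq(1)[of t] by (simp add: integral_unif_d)
  also have "\<dots> = D t - (h t - \<beta>)\<^sup>2 / (t - q)"
  proof -
    have "k * (t - q) = h t - \<beta>" using assms by (simp add: k_def)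
    then have "k\<^sup>2 * (t - q) = k * (h t - \<beta>)" by (simp add: power2_eq_square mult.assoc)
    moreover have "(h t - \<beta>)\<^sup>2 / (t - q) = k * (h t - \<beta>)" by (simp add: k_def power2_eq_square)
    ultimately show ?thesis by simp
  qed
  finally have *: "(h t - \<beta>)\<^sup>2 / (t - q) \<le> D t" by simp
  have "(h t - \<beta>)\<^sup>2 \<le> (t - q) * D t"
    using * assms by (simp add: pos_divide_le_eq mult.commute)
  also have "0 < (h t - \<beta>)\<^sup>2 / (t - q)" using H assms by simp
  then have "(t - q) * D t < t * D t" using * q by (intro mult_strict_right_mono) auto
  finally show ?thesis .
qed

text \<open>The left-hand side of the inequality in \<open>trunc_feasible\<close>, with \<open>\<kappa>\<close> in place of \<open>h'(t)\<close>.\<close>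

definition gap :: "real \<Rightarrow> real \<Rightarrow> real \<Rightarrow> real" where
  "gap r t \<kappa> = (1 + r\<^sup>2) * (t * \<kappa> - (h t - \<beta>))\<^sup>2 - (\<kappa>\<^sup>2 * t - 2 * \<kappa> * (h t - \<beta>) + D t)"

lemma integral_trunc_feasible:
  assumes "q \<le> t" "t \<le> 1"
  shows "(LBINT u:{0..t}. (\<kappa> - indicator {crit_level h \<beta><..} u * dist_deriv_real h u)\<^sup>2)
    = \<kappa>\<^sup>2 * t - 2 * \<kappa> * (h t - \<beta>) + D t"
proof -
  let ?f = "\<lambda>u. (\<kappa> - indicator {q<..} u * d u)\<^sup>2"
  note ints = integrable_indicator_times[OF integrable_d, of q t] integrable_indicator_times[OF integrable_d2, of q t]
    integrable_indicator_times[of "\<lambda>_. 1" 0 t, simplified]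
  have "integrable unif (\<lambda>u. \<kappa>\<^sup>2 - 2 * \<kappa> * (indicator {q<..} u * d u) + indicator {q<..} u * (d u)\<^sup>2)"
    using integrable_unif_indicator[OF integrable_d] integrable_unif_indicator[OF integrable_d2] by simp
  also have "(\<lambda>u. \<kappa>\<^sup>2 - 2 * \<kappa> * (indicator {q<..} u * d u) + indicator {q<..} u * (d u)\<^sup>2) = ?f"
    by (auto simp: fun_eq_iff indicator_def power2_eq_square algebra_simps)
  finally have "integrable unif ?f" .
  then have "(LBINT u:{0..t}. ?f u) = (LINT u|unif. indicator {0<..t} u * ?f u)"
    using integral_unif_indicator(1,2)[of ?f 0 t] assms q by simp
  also have "\<dots> = (LINT u|unif. \<kappa>\<^sup>2 * indicator {0<..t} u - 2 * \<kappa> * (indicator {q<..t} u * d u)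
      + indicator {q<..t} u * (d u)\<^sup>2)"
    using q by (intro Bochner_Integration.integral_cong) (auto simp: power2_eq_square algebra_simps indicator_def)
  also have "\<dots> = \<kappa>\<^sup>2 * t - 2 * \<kappa> * (h t - \<beta>) + D t"
    using ints assms q integral_unif_indicator_1[of 0 t] D_eq(1)[of t] by (simp add: integral_unif_d)
  finally show ?thesis by (simp add: q_def d_def)
qed

lemma trunc_feasible_iff:
  assumes "q \<le> t" "t \<le> 1" "dist_deriv h t = ereal \<kappa>" "1 / (1 + r\<^sup>2) \<le> t"
  shows "trunc_feasible h \<beta> r t \<longleftrightarrow> gap r t \<kappa> \<le> 0"
proof -
  have I: "(LBINT u:{0..t}. (dist_deriv_real h t - indicator {crit_level h \<beta><..} u * dist_deriv_real h u)\<^sup>2)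
      = \<kappa>\<^sup>2 * t - 2 * \<kappa> * (h t - \<beta>) + D t"
    using integral_trunc_feasible[OF assms(1,2), of \<kappa>] assms(3) by simp
  have sq: "(ereal y)\<^sup>2 = ereal (y\<^sup>2)" for y by (simp add: power2_eq_square)
  have H: "t * \<kappa> - h t + \<beta> = t * \<kappa> - (h t - \<beta>)" by simp
  have "ereal (1 + r\<^sup>2) * (ereal t * dist_deriv h t - ereal (h t) + ereal \<beta>)\<^sup>2
      - ereal (\<kappa>\<^sup>2 * t - 2 * \<kappa> * (h t - \<beta>) + D t) = ereal (gap r t \<kappa>)"
    unfolding assms(3) times_ereal.simps ereal_minus plus_ereal.simps H sq gap_def ..
  then show ?thesis
    unfolding trunc_feasible_def I using assms(2,4) by simp
qed

lemma not_trunc_feasible_infinite: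
  assumes "dist_deriv h 1 = \<infinity>"
  shows "\<not> trunc_feasible h \<beta> r 1"
  using assms add_pos_nonneg[of 1 "r\<^sup>2"] by (auto simp: trunc_feasible_def power2_eq_square)

lemma H_le_t_d:
  assumes "q < t" "t < 1"
  shows "h t - \<beta> \<le> t * d t"
proof -
  have "h t - \<beta> \<le> (t - q) * d t"
    using slope_le_d[of q t] q assms by (simp add: slope_def field_simps)
  also have "\<dots> \<le> t * d t" using assms q d_nonneg[of t] by (intro mult_right_mono) auto
  finally show ?thesis .
qed

lemma h_D_at_left:
  assumes "q < t" "t \<le> 1"
  shows "(h \<longlongrightarrow> h t) (at_left t)" and "(D \<longlongrightarrow> D t) (at_left t)"
proof -
  have "continuous_on {q..t} h" "continuous_on {q..t} D"
    using h_cont D_cont q assms by (auto elim: continuous_on_subset)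
  then show "(h \<longlongrightarrow> h t) (at_left t)" "(D \<longlongrightarrow> D t) (at_left t)"
    using assms by (auto intro: continuous_on_Icc_at_leftD)
qed

lemma h_D_at_right:
  assumes "q \<le> t" "t < 1"
  shows "(h \<longlongrightarrow> h t) (at_right t)" and "(D \<longlongrightarrow> D t) (at_right t)"
proof -
  have "continuous_on {t..1} h" "continuous_on {t..1} D"
    using h_cont D_cont q assms by (auto elim: continuous_on_subset)
  then show "(h \<longlongrightarrow> h t) (at_right t)" "(D \<longlongrightarrow> D t) (at_right t)"
    using assms by (auto intro: continuous_on_Icc_at_rightD)
qed

text \<open>Failure of feasibility at \<open>t\<close> persists just to the left of
  \<open>t\<close>; this is what makes the supremum of the feasible levels a maximum.\<close>

lemma eventually_gap_pos:
  assumes r: "0 < r" and t: "q < t" "t \<le> 1"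
    and pos: "\<And>\<kappa>. dist_deriv h t = ereal \<kappa> \<Longrightarrow> 0 < gap r t \<kappa>"
  shows "\<forall>\<^sub>F u in at_left t. 0 < gap r u (d u)"
proof (cases "dist_deriv h t")
  case (real \<kappa>)
  have "(dist_deriv h \<longlongrightarrow> ereal \<kappa>) (at_left t)"
    using dist_deriv_left_cont[of t] t q real by simp
  then have "(d \<longlongrightarrow> \<kappa>) (at_left t)"
    unfolding d_def[abs_def] by (rule lim_real_of_ereal)
  then have "((\<lambda>u. gap r u (d u)) \<longlongrightarrow> gap r t \<kappa>) (at_left t)"
    unfolding gap_def by (intro tendsto_intros h_D_at_left t)
  then show ?thesis using pos[OF real] by (rule order_tendstoD)
next
  case PInf
  then have t1: "t = 1" using dist_deriv_real[of t] t q by (cases "t = 1") auto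
  have ev: "\<forall>\<^sub>F u in at_left 1. u \<in> {0<..<1::real}"
    by (intro eventually_at_leftI[of 0]) auto
  have "(dist_deriv h \<longlongrightarrow> \<infinity>) (at_left 1)"
    using dist_deriv_left_cont[of t] t q PInf t1 by simp
  moreover have "\<forall>\<^sub>F u in at_left 1. dist_deriv h u = ereal (d u)"
    using ev by eventually_elim (auto simp: dist_deriv_real)
  ultimately have "((\<lambda>u. ereal (d u)) \<longlongrightarrow> \<infinity>) (at_left 1)"
    by (simp cong: tendsto_cong)
  then have top: "filterlim d at_top (at_left 1)"
    by (simp add: tendsto_PInfty_eq_at_top)
  then have inv: "((\<lambda>u. inverse (d u)) \<longlongrightarrow> 0) (at_left 1)"
    by (rule tendsto_inverse_0_at_top)
  \<comment> \<open>When \<open>d\<close> tends to \<infinity>, the gap is divided by the square of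
    \<open>d\<close>: all terms but the leading ones vanish, and the limit is (1 + r^2) - 1 =
    r^2.\<close>
  define g where "g u = (1 + r\<^sup>2) * (u - (h u - \<beta>) * inverse (d u))\<^sup>2
    - (u - 2 * inverse (d u) * (h u - \<beta>) + D u * (inverse (d u))\<^sup>2)" for u
  have "(g \<longlongrightarrow> (1 + r\<^sup>2) * (1 - (h 1 - \<beta>) * 0)\<^sup>2 - (1 - 2 * 0 * (h 1 - \<beta>) + D 1 * 0\<^sup>2)) (at_left 1)"
    unfolding g_def[abs_def] using q by (intro tendsto_intros inv h_D_at_left) auto
  then have "(g \<longlongrightarrow> r\<^sup>2) (at_left 1)" by simp
  then have "\<forall>\<^sub>F u in at_left 1. 0 < g u" by (rule order_tendstoD) (use r in simp)
  moreover have "\<forall>\<^sub>F u in at_left 1. 0 < d u"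
    using top by (simp add: filterlim_at_top_dense)
  ultimately show ?thesis unfolding t1
  proof eventually_elim
    case (elim u)
    have "gap r u (d u) = (d u)\<^sup>2 * g u"
      using elim(2) by (simp add: gap_def g_def field_simps power2_eq_square)
    then show ?case using elim by simp
  qed
next
  case MInf
  then show ?thesis using dist_deriv_nonneg[of t] t q by simp
qed

text \<open>The threshold of the low-dispersion case is the feasibility inequality at t = 1: squared
  and expanded, it is r^2 (\<kappa> - H)^2 compared with D - H^2.\<close>

lemma ratio_low_less_iff:
  assumes "dist_deriv h 1 = ereal \<kappa>" "0 \<le> r"
  shows "ratio_low h \<beta> < ereal r \<longleftrightarrow> 0 < gap r 1 \<kappa>"
proof -
  have "ereal (slope 0 1) \<le> dist_deriv h 1" by (rule slope_le_dist_deriv) auto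
  then have \<kappa>: "0 < \<kappa> - (1 - \<beta>)" using assms beta by (simp add: slope_def)
  have H: "h 1 - \<beta> = 1 - \<beta>" by simp
  have "ratio_low h \<beta> < ereal r \<longleftrightarrow> Delta h \<beta> 1 < r * (\<kappa> - (1 - \<beta>))"
    using \<kappa> by (simp add: ratio_low_def assms(1) pos_divide_less_eq)
  also have "\<dots> \<longleftrightarrow> (Delta h \<beta> 1)\<^sup>2 < (r * (\<kappa> - (1 - \<beta>)))\<^sup>2"
  proof
    assume *: "Delta h \<beta> 1 < r * (\<kappa> - (1 - \<beta>))"
    have "0 \<le> Delta h \<beta> 1" using sq_H_less[of 1] q by (simp add: Delta_eq)
    with * show "(Delta h \<beta> 1)\<^sup>2 < (r * (\<kappa> - (1 - \<beta>)))\<^sup>2" by (intro power_strict_mono) auto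
  next
    assume "(Delta h \<beta> 1)\<^sup>2 < (r * (\<kappa> - (1 - \<beta>)))\<^sup>2"
    then show "Delta h \<beta> 1 < r * (\<kappa> - (1 - \<beta>))"
      by (rule power_less_imp_less_base) (use \<kappa> assms in auto)
  qed
  also have "(Delta h \<beta> 1)\<^sup>2 = D 1 - (1 - \<beta>)\<^sup>2"
    using sq_H_less[of 1] q by (simp add: Delta_eq)
  also have "D 1 - (1 - \<beta>)\<^sup>2 < (r * (\<kappa> - (1 - \<beta>)))\<^sup>2 \<longleftrightarrow> 0 < gap r 1 \<kappa>"
    unfolding gap_def by (simp add: power2_eq_square algebra_simps)
  finally show ?thesis .
qed

text \<open>
  The feasible set contains \<open>1 / (1 + r\<^sup>2)\<close> but not \<open>1\<close>. Its supremum is attained because \<open>h'\<close> is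
  left-continuous as an extended real function.
\<close>

lemma trunc_level_properties:
  assumes r: "0 < r" and rq: "q < 1 / (1 + r\<^sup>2)" and low: "ratio_low h \<beta> < ereal r"
  defines "T \<equiv> trunc_level h \<beta> r"
  shows "1 / (1 + r\<^sup>2) \<le> T" "T < 1" "gap r T (d T) \<le> 0"
    and "\<And>u. T < u \<Longrightarrow> u < 1 \<Longrightarrow> 0 < gap r u (d u)"
proof -
  let ?S = "{t. trunc_feasible h \<beta> r t}"
  define t0 where "t0 = 1 / (1 + r\<^sup>2)"
  have t0: "q < t0" "t0 < 1" using r rq by (auto simp: t0_def add_pos_nonneg)
  have ltS: "t \<in> ?S \<longleftrightarrow> gap r t (d t) \<le> 0" if "t0 \<le> t" "t < 1" for t
    using trunc_feasible_iff[of t "d t" r] dist_deriv_real[of t] that t0 q by (simp add: t0_def)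
  have S_bounds: "t0 \<le> t \<and> t \<le> 1" if "t \<in> ?S" for t
    using that by (simp add: trunc_feasible_def t0_def)
  have one: "1 \<notin> ?S"
  proof (cases "dist_deriv h 1")
    case (real \<kappa>)
    then have "0 < gap r 1 \<kappa>" using ratio_low_less_iff[OF real, of r] low r by simp
    then show ?thesis using trunc_feasible_iff[OF _ _ real, of r] q t0 by (simp add: t0_def)
  next
    case PInf
    then show ?thesis using not_trunc_feasible_infinite by simp
  next
    case MInf
    then show ?thesis using dist_deriv_nonneg[of 1] by simp
  qed
  \<comment> \<open>At \<open>t0\<close> the factor 1 + r^2 cancels against t0, so \<kappa> drops
    out and t0 times the gap is H^2 - t0 D, which is negative by Cauchy-Schwarz.\<close>
  have "t0 \<in> ?S"
  proof -
    have "(1 + r\<^sup>2) * t0 = 1" using add_pos_nonneg[of 1 "r\<^sup>2"] by (simp add: t0_def)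
    then have "t0 * gap r t0 \<kappa> = (t0 * \<kappa> - (h t0 - \<beta>))\<^sup>2 - t0 * (\<kappa>\<^sup>2 * t0 - 2 * \<kappa> * (h t0 - \<beta>) + D t0)" for \<kappa>
      unfolding gap_def right_diff_distrib[of t0] mult.assoc[symmetric] by (simp add: mult.commute)
    then have "t0 * gap r t0 \<kappa> = (h t0 - \<beta>)\<^sup>2 - t0 * D t0" for \<kappa>
      by (simp add: power2_eq_square algebra_simps)
    then have "t0 * gap r t0 \<kappa> < 0" for \<kappa> using sq_H_less[of t0] t0 by simp
    then have "gap r t0 (d t0) < 0" using t0 q by (simp add: mult_less_0_iff)
    then show ?thesis using ltS[of t0] t0 by simp
  qed
  then have ne: "?S \<noteq> {}" by blast
  have bdd: "bdd_above ?S" using S_bounds by (intro bdd_aboveI[of _ 1]) auto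
  define M where "M = Sup ?S"
  have upper: "t \<le> M" if "t \<in> ?S" for t unfolding M_def by (rule cSup_upper[OF that bdd])
  have M: "t0 \<le> M" "M \<le> 1"
    using upper[OF \<open>t0 \<in> ?S\<close>] cSup_least[OF ne, of 1] S_bounds by (auto simp: M_def)
  have "M \<in> ?S"
  proof (rule ccontr)
    assume nM: "M \<notin> ?S"
    have "0 < gap r M \<kappa>" if "dist_deriv h M = ereal \<kappa>" for \<kappa>
      using trunc_feasible_iff[OF _ _ that, of r] nM M t0 by (auto simp: t0_def not_le)
    then have "\<forall>\<^sub>F u in at_left M. 0 < gap r u (d u)"
      using eventually_gap_pos[OF r, of M] M t0 by auto
    moreover have "q < M" using M t0 by simp
    ultimately obtain b where b: "b < M" "\<And>u. b < u \<Longrightarrow> u < M \<Longrightarrow> 0 < gap r u (d u)"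
      unfolding eventually_at_left[OF \<open>q < M\<close>] by blast
    obtain t where t: "t \<in> ?S" "b < t"
      using b(1) less_cSup_iff[OF ne bdd] by (auto simp: M_def)
    have "t < M" using upper[OF t(1)] t(1) nM by (cases "t = M") auto
    moreover have "gap r t (d t) \<le> 0" using ltS[of t] t(1) S_bounds[OF t(1)] \<open>t < M\<close> M by auto
    ultimately show False using b(2)[of t] t(2) by simp
  qed
  moreover have "T = M"
    unfolding T_def trunc_level_def
    using \<open>M \<in> ?S\<close> upper by (intro Greatest_equality) auto
  ultimately have TS: "T \<in> ?S" by simp
  show "1 / (1 + r\<^sup>2) \<le> T" using S_bounds[OF TS] by (simp add: t0_def)
  show "T < 1" using S_bounds[OF TS] one TS by (cases "T = 1") auto
  then show "gap r T (d T) \<le> 0" using TS ltS[of T] S_bounds[OF TS] by simp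
  fix u assume u: "T < u" "u < 1"
  then have "u \<notin> ?S" using upper[of u] \<open>T = M\<close> by auto
  then show "0 < gap r u (d u)" using ltS[of u] u S_bounds[OF TS] by auto
qed

text \<open>Common end of the cases of low dispersion, with t = 1, and of intermediate dispersion:
  once \<open>t\<close> is a true cut-off, the moment identities turn the saddle point into the
  closed form. Strictness in \<open>m\<close> makes B positive.\<close>

lemma saddle_point_of_level:
  assumes pc: "0 < p" "0 < c" "\<beta> = c / p" and t: "q < t" "t \<le> 1"
    and m: "m\<^sup>2 < t * (m\<^sup>2 + s\<^sup>2)"
    and tau: "dist_deriv h q \<le> ereal \<tau>" "ereal \<tau> \<le> dist_deriv_right h q"
  defines "A \<equiv> trunc_intercept m s t (h t - \<beta>) (D t)" and "B \<equiv> trunc_slope m s t (h t - \<beta>) (D t)"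
  assumes below: "\<And>u. 0 < u \<Longrightarrow> u < t \<Longrightarrow> B * d u \<le> A"
    and above: "\<And>u. t < u \<Longrightarrow> u < 1 \<Longrightarrow> A \<le> B * d u"
  shows "\<exists>Y a b. saddle_point p c m s
    (m / t - sigma_trunc m s t / t * ((t * \<tau> - 2 * (h t - \<beta>)) / (2 * Delta h \<beta> t)))
    (p / t * (- m * (h t - \<beta>) + sigma_trunc m s t * Delta h \<beta> t)) Y a b"
proof -
  have t0: "0 < t" using t q by simp
  note \<Delta> = sq_H_less[OF t]
  have D: "Delta h \<beta> t = sqrt (t * D t - (h t - \<beta>)\<^sup>2)" using t by (simp add: Delta_eq)
  have "0 < sigma_trunc m s t" using m by (simp add: sigma_trunc_def)
  then have B: "0 < B" using \<Delta> by (simp add: B_def trunc_slope_def)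
  have hq: "h q = c / p" using q pc by simp
  have \<tau>q: "d q \<le> \<tau>" using tau(1) q by (simp add: dist_deriv_real)
  have \<tau>u: "\<tau> \<le> d u" if "q < u" "u < 1" for u
    using order_trans[OF tau(2) dist_deriv_right_le[of q u]] that q by (simp add: dist_deriv_real)
  note mom = trunc_moments[OF t0 less_imp_le[OF m] \<Delta>, folded A_def B_def]
  have "saddle_point p c m s (A - B * \<tau> / 2) (- p * (A * (h t - c / p) - B * D t))
    (\<lambda>u. if u \<le> q then A else max 0 (A - B * d u)) (p / (2 * B)) (- p * A / B)"
    using saddle_point_truncated[OF pc(1,2) q(1) t hq B below above \<tau>q \<tau>u, of m s] mom(1,2) D_eq(1)[of t] t pc(3)
    by simp
  moreover have "- p * (A * (h t - c / p) - B * D t) = p / t * (- m * (h t - \<beta>) + sigma_trunc m s t * Delta h \<beta> t)"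
    unfolding pc(3)[symmetric] mom(3) D using t0 by (simp add: field_simps)
  ultimately show ?thesis unfolding mom(4) D by metis
qed

lemma mean_sq_le_iff:
  fixes m s t :: real
  assumes "0 < m"
  shows "1 / (1 + (s / m)\<^sup>2) \<le> t \<longleftrightarrow> m\<^sup>2 \<le> t * (m\<^sup>2 + s\<^sup>2)"
proof -
  have "1 + (s / m)\<^sup>2 = (m\<^sup>2 + s\<^sup>2) / m\<^sup>2" using assms by (simp add: field_simps)
  moreover have "0 < m\<^sup>2 + s\<^sup>2" using assms by (simp add: add_pos_nonneg)
  ultimately show ?thesis using assms by (simp add: pos_divide_le_eq)
qed

lemma saddle_point_low_dispersion:
  assumes pc: "0 < p" "0 < c" "c < p" "\<beta> = c / p" and m: "0 < m" "0 \<le> s"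
    and low: "ereal (s / m) \<le> ratio_low h \<beta>"
    and tau: "dist_deriv h q \<le> ereal \<tau>" "ereal \<tau> \<le> dist_deriv_right h q"
  shows "\<exists>Y a b. saddle_point p c m s (m - s * ((\<tau> - 2 * (1 - \<beta>)) / (2 * Delta h \<beta> 1)))
    (- m * (p - c) + p * s * Delta h \<beta> 1) Y a b"
proof (cases "s = 0")
  case True
  have "saddle_point p c m 0 m (- m * (p - c)) (\<lambda>_. m) 0 0"
    using pc m by (intro saddle_point_deterministic) auto
  then show ?thesis using True by auto
next
  case False
  then have s: "0 < s" using m by simp
  \<comment> \<open>An infinite slope would make the threshold a finite number over \<infinity>,
    hence 0, which contradicts s > 0.\<close>
  have "dist_deriv h 1 \<noteq> \<infinity>"
  proof
    assume "dist_deriv h 1 = \<infinity>"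
    then have "ratio_low h \<beta> = 0" by (simp add: ratio_low_def)
    then show False using low divide_pos_pos[OF s m(1)] by simp
  qed
  then obtain \<kappa> where \<kappa>: "dist_deriv h 1 = ereal \<kappa>"
    using dist_deriv_nonneg[of 1] by (cases "dist_deriv h 1") auto
  let ?A = "trunc_intercept m s 1 (h 1 - \<beta>) (D 1)" and ?B = "trunc_slope m s 1 (h 1 - \<beta>) (D 1)"
  have d\<kappa>: "d u \<le> \<kappa>" if "0 < u" "u < 1" for u
    using dist_deriv_mono[of u 1] that \<kappa> by (simp add: dist_deriv_real)
  have "ereal (slope 0 1) \<le> dist_deriv h 1" by (rule slope_le_dist_deriv) auto
  then have "h 1 - \<beta> \<le> 1 * \<kappa>" using \<kappa> beta by (simp add: slope_def)
  moreover have "gap (s / m) 1 \<kappa> \<le> 0"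
    using ratio_low_less_iff[OF \<kappa> divide_nonneg_pos[OF m(2,1)]] low by (metis not_le)
  ultimately have B\<kappa>: "?B * \<kappa> \<le> ?A"
    using trunc_slope_le_intercept_iff[of m 1 s "h 1 - \<beta>" "D 1" \<kappa>] m sq_H_less[of 1] q
    by (simp add: gap_def)
  have "0 \<le> ?B" using sq_H_less[of 1] q by (simp add: trunc_slope_def sigma_trunc_def)
  then have "?B * d u \<le> ?A" if "0 < u" "u < 1" for u
    using mult_left_mono[OF d\<kappa>[OF that]] B\<kappa> by (meson order_trans)
  moreover have "sigma_trunc m s 1 = s" using s by (simp add: sigma_trunc_def)
  moreover have "p / 1 * (- m * (1 - \<beta>) + s * Delta h \<beta> 1) = - m * (p - c) + p * s * Delta h \<beta> 1"
    using pc by (simp add: field_simps)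
  ultimately show ?thesis
    using saddle_point_of_level[OF pc(1,2,4), of 1 m s \<tau>] q tau s by simp
qed

lemma saddle_point_mid_dispersion:
  assumes pc: "0 < p" "0 < c" "\<beta> = c / p" and m: "0 < m" "0 \<le> s"
    and low: "ratio_low h \<beta> < ereal (s / m)" and high: "s / m < ratio_high h \<beta>"
    and t: "t = trunc_level h \<beta> (s / m)"
    and tau: "dist_deriv h q \<le> ereal \<tau>" "ereal \<tau> \<le> dist_deriv_right h q"
  shows "\<exists>Y a b. saddle_point p c m s
    (m / t - sigma_trunc m s t / t * ((t * \<tau> - 2 * (h t - \<beta>)) / (2 * Delta h \<beta> t)))
    (p / t * (- m * (h t - \<beta>) + sigma_trunc m s t * Delta h \<beta> t)) Y a b"
proof -
  let ?r = "s / m"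
  \<comment> \<open>For s = 0 and a finite slope the gap at 1 is negative, against
    \<open>low\<close>; with an infinite slope the threshold is 0.\<close>
  have r: "0 < ?r"
  proof (cases "dist_deriv h 1")
    case (real \<kappa>)
    have "0 < gap ?r 1 \<kappa>" using ratio_low_less_iff[OF real, of ?r] low m by simp
    moreover have "gap 0 1 \<kappa> < 0" using sq_H_less[of 1] q by (simp add: gap_def power2_eq_square algebra_simps)
    ultimately have "s \<noteq> 0" by auto
    then show ?thesis using m by simp
  next
    case PInf
    then have "ratio_low h \<beta> = 0" by (simp add: ratio_low_def)
    then show ?thesis using low by simp
  next
    case MInf
    then show ?thesis using dist_deriv_nonneg[of 1] by simp
  qed
  have "?r\<^sup>2 < 1 / q - 1"
    using high r unfolding ratio_high_def q_def[symmetric]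
    by (metis less_imp_le not_le real_sqrt_abs real_sqrt_less_iff abs_of_pos)
  then have "1 + ?r\<^sup>2 < 1 / q" by simp
  then have rq: "q < 1 / (1 + ?r\<^sup>2)" using q by (simp add: field_simps add_pos_nonneg)
  note T = trunc_level_properties[OF r rq low, folded t]
  have tq: "q < t" using T(1) rq by simp
  define A where "A u = trunc_intercept m s u (h u - \<beta>) (D u)" for u
  define B where "B u = trunc_slope m s u (h u - \<beta>) (D u)" for u
  have iff: "B u * \<kappa> \<le> A u \<longleftrightarrow> gap ?r u \<kappa> \<le> 0" if "t \<le> u" "u < 1" "h u - \<beta> \<le> u * \<kappa>" for u \<kappa>
    unfolding A_def B_def gap_def
    using that mean_sq_le_iff[OF m(1), of s u] T(1) sq_H_less[of u] tq q m
    by (intro trunc_slope_le_intercept_iff) auto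
  have B0: "0 \<le> B u" if "t \<le> u" "u < 1" for u
    using that mean_sq_le_iff[OF m(1), of s u] T(1) sq_H_less[of u] tq
    by (auto simp: B_def trunc_slope_def sigma_trunc_def)
  have below: "B t * d u \<le> A t" if "0 < u" "u < t" for u
  proof -
    have "B t * d u \<le> B t * d t" using that T B0[of t] d_mono[of u t] by (intro mult_left_mono) auto
    also have "\<dots> \<le> A t" using iff[of t "d t"] T H_le_t_d[of t] tq by simp
    finally show ?thesis .
  qed
  \<comment> \<open>Infeasibility gives A(u) \<le> B(u) d(u) \<le> B(u) d(w) for t < u < w. Keeping
    w fixed while u decreases to t uses only the continuity of A and B, so a jump of
    \<open>d\<close> at t does no harm.\<close>
  have above: "A t \<le> B t * d w" if w: "t < w" "w < 1" for w
  proof -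
    have nz: "sqrt (t * D t - (h t - \<beta>)\<^sup>2) \<noteq> 0" using sq_H_less[of t] tq T by simp
    have limB: "(B \<longlongrightarrow> B t) (at_right t)"
      unfolding B_def[abs_def] trunc_slope_def sigma_trunc_def
      using tq T nz by (intro tendsto_intros h_D_at_right) auto
    have limA: "(A \<longlongrightarrow> A t) (at_right t)"
      unfolding A_def[abs_def] trunc_intercept_def B_def[symmetric]
      using tq T q by (intro tendsto_intros h_D_at_right limB) auto
    show ?thesis
    proof (rule tendsto_le[OF _ _ limA])
      show "((\<lambda>u. B u * d w) \<longlongrightarrow> B t * d w) (at_right t)"
        by (intro tendsto_intros limB)
      have "\<forall>\<^sub>F u in at_right t. u \<in> {t<..<w}" using w by (intro eventually_at_rightI[of t w]) auto
      then show "\<forall>\<^sub>F u in at_right t. A u \<le> B u * d w"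
      proof eventually_elim
        case (elim u)
        then have u: "t < u" "u < 1" "u < w" using w by auto
        have "A u \<le> B u * d u"
          using iff[of u "d u"] T(4)[of u] H_le_t_d[of u] u tq by auto
        also have "\<dots> \<le> B u * d w" using u B0[of u] d_mono[of u w] w tq q by (intro mult_left_mono) auto
        finally show ?case .
      qed
    qed simp
  qed
  \<comment> \<open>Equality would mean B = 0 while A = m / t > 0, contradicting
    \<open>above\<close> at any level beyond t.\<close>
  have "m\<^sup>2 < t * (m\<^sup>2 + s\<^sup>2)"
  proof (rule ccontr)
    assume "\<not> ?thesis"
    then have "t * (m\<^sup>2 + s\<^sup>2) = m\<^sup>2" using mean_sq_le_iff[OF m(1), of s t] T(1) by simp
    then have "B t = 0" by (simp add: B_def trunc_slope_def sigma_trunc_def)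
    moreover have "0 < A t" using \<open>B t = 0\<close> m tq q by (simp add: A_def trunc_intercept_def B_def)
    ultimately show False using above[of "(t + 1) / 2"] T by simp
  qed
  then show ?thesis
    using tq T tau below above unfolding A_def B_def by (intro saddle_point_of_level pc) auto
qed

end

lemma (in sq_distortion) saddle_point_single_solution:
  assumes sol: "single_solution h p c m s x v"
    and pc: "0 < c" "c < p" and m: "0 < m" "0 \<le> s"
  shows "\<exists>Y a b. saddle_point p c m s x v Y a b"
proof -
  have p: "0 < p" using pc by simp
  interpret L: sq_distortion_level h "c / p"
    by unfold_locales (use pc p in auto)
  from sol show ?thesis
  proof cases
    case no_order
    \<comment> \<open>This is the probability for which the two-valued demand has the prescribed
      second moment; the case condition, squared, says that it is at most the critical
      level.\<close>
    define t where "t = 1 / (1 + (s / m)\<^sup>2)"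
    have "1 / L.q - 1 \<le> (s / m)\<^sup>2"
      using no_order by (simp add: ratio_high_def L.q_def sqrt_le_D)
    then have "1 / L.q \<le> 1 + (s / m)\<^sup>2" by simp
    then have "t \<le> L.q"
      using L.q by (simp add: t_def field_simps add_pos_nonneg)
    moreover have "0 < t" by (simp add: t_def add_pos_nonneg)
    moreover have "m\<^sup>2 / t = m\<^sup>2 + s\<^sup>2" using m by (simp add: t_def field_simps)
    ultimately have "saddle_point p c m s 0 0 (\<lambda>u. m / t * indicator {0<..t} u) 0 0"
      using saddle_point_no_order[of p c L.q t m s] L.q p pc m by simp
    then show ?thesis using no_order by blast
  next
    case (low_dispersion \<beta> \<tau>)
    then show ?thesis
      using L.saddle_point_low_dispersion[OF p pc refl m, of \<tau>] by (simp add: L.q_def)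
  next
    case (mid_dispersion \<beta> t \<tau>)
    then show ?thesis
      using L.saddle_point_mid_dispersion[OF p pc(1) refl m, of t \<tau>] by (simp add: L.q_def)
  qed
qed

theorem theorem6p1:
  fixes h :: "real \<Rightarrow> real"
    and p c \<mu> \<sigma> x v :: "real ^ 'n"
  assumes "convex_distortion h"
    and "square_integrable_deriv h"
    and "\<And>i. 0 < c $ i"
    and "\<And>i. c $ i < p $ i"
    and "\<And>i. 0 < \<mu> $ i"
    and "\<And>i. 0 \<le> \<sigma> $ i"
    and "\<And>i. single_solution h (p $ i) (c $ i) (\<mu> $ i) (\<sigma> $ i) (x $ i) (v $ i)"
  shows "multi_optimal_value h p c \<mu> \<sigma> = multi_worst_case h p c \<mu> \<sigma> x
    \<and> multi_worst_case h p c \<mu> \<sigma> x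
        = (\<Sum>i\<in>UNIV. optimal_value h (p $ i) (c $ i) (\<mu> $ i) (\<sigma> $ i))
    \<and> (\<forall>i. 0 \<le> x $ i
          \<and> worst_case h (p $ i) (c $ i) (\<mu> $ i) (\<sigma> $ i) (x $ i)
              = optimal_value h (p $ i) (c $ i) (\<mu> $ i) (\<sigma> $ i)
          \<and> optimal_value h (p $ i) (c $ i) (\<mu> $ i) (\<sigma> $ i) = ereal (v $ i))"
proof -
  interpret sq_distortion h using assms(1,2) by unfold_locales
  have "\<forall>i. \<exists>Y a b. saddle_point (p $ i) (c $ i) (\<mu> $ i) (\<sigma> $ i) (x $ i) (v $ i) Y a b"
    using saddle_point_single_solution[OF assms(7,3-6)] by blast
  then obtain Y a b where
    sp: "\<And>i. saddle_point (p $ i) (c $ i) (\<mu> $ i) (\<sigma> $ i) (x $ i) (v $ i) (Y i) (a i) (b i)"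
    by metis
  show ?thesis
    using multi_worst_case_saddle_point[OF sp] worst_case_saddle_point[OF sp] saddle_pointD(3)[OF sp]
    by (simp add: sum_ereal)
qed

end
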